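(* Let $\mathbb{K}$ be an algebraically closed field of characteristic zero. There are infinitely many equivalence classes of additive actions on $Q(4,4)$.
   Context: $Q(n,k)$ denotes the quadric of dimension $n$ and rank $k$ in the projective space $\mathbb{P}^{n+1}$ over $\mathbb{K}$, i.e. the zero locus of a quadratic form of rank $k$ in $n+2$ variables. $\mathbb{G}_a$ is the additive group of $\mathbb{K}$, and $\mathbb{G}_a^n = \mathbb{G}_a\times\ldots\times\mathbb{G}_a$ ($n$ times). An additive action on an irreducible algebraic variety $X$ of dimension $n$ over $\mathbb{K}$ is a regular action $\mathbb{G}_a^n\times X\to X$ with an open orbit. An additive action of the group $\mathbb{G}_a^n$ on a variety $X$ is equivalent to an additive action of $\mathbb{G}_a^n$ on a variety $Y$ if there is a $\mathbb{G}_a^n$-equivariant isomorphism between $X$ and $Y$. *)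

theory Defs
  imports "HOL-Analysis.Analysis" "HOL-Computational_Algebra.Computational_Algebra"
begin

section \<open>Polynomials and the Zariski topology\<close>

text \<open>Over an infinite field polynomials may be identified with polynomial functions. The following
  is the algebra of functions generated by a set of coordinate functions.\<close>

inductive_set polynomial_functions :: "('p \<Rightarrow> 'k::comm_ring_1) set \<Rightarrow> ('p \<Rightarrow> 'k) set"
  for C :: "('p \<Rightarrow> 'k) set" where
  const: "(\<lambda>_. c) \<in> polynomial_functions C"
| coord: "f \<in> C \<Longrightarrow> f \<in> polynomial_functions C"
| add: "f \<in> polynomial_functions C \<Longrightarrow> g \<in> polynomial_functions C \<Longrightarrow>
    (\<lambda>p. f p + g p) \<in> polynomial_functions C"
| mult: "f \<in> polynomial_functions C \<Longrightarrow> g \<in> polynomial_functions C \<Longrightarrow>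
    (\<lambda>p. f p * g p) \<in> polynomial_functions C"

definition affine_polys :: "(('k::field ^ 'm) \<Rightarrow> 'k) set" where
  "affine_polys = polynomial_functions (range (\<lambda>i t. t $ i))"

text \<open>Since the field is infinite, homogeneity of degree \<open>d\<close> can be tested on values; the zero
  polynomial is homogeneous of every degree.\<close>

definition forms :: "nat \<Rightarrow> (('k::field_char_0 ^ 'n) \<Rightarrow> 'k) set" where
  "forms d = {f \<in> affine_polys. \<forall>c z. f (c *s z) = c ^ d * f z}"

text \<open>Polynomials on \<open>\<A>\<^sup>m \<times> K\<^sup>n\<close> that are homogeneous of degree \<open>d\<close> in the second argument.\<close>

definition rel_forms :: "nat \<Rightarrow> (('k::field_char_0 ^ 'm) \<times> ('k ^ 'n) \<Rightarrow> 'k) set" where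
  "rel_forms d =
     {f \<in> polynomial_functions (range (\<lambda>i (t, z). t $ i) \<union> range (\<lambda>j (t, z). z $ j)).
        \<forall>c t z. f (t, c *s z) = c ^ d * f (t, z)}"

text \<open>Points of \<open>\<P>\<^sup>n\<^sup>-\<^sup>1\<close> are represented by the lines in \<open>K\<^sup>n\<close>.\<close>

definition line :: "'k::field ^ 'n \<Rightarrow> ('k ^ 'n) set" where
  "line z = vec.span {z}"

definition zariski :: "('k::field_char_0 ^ 'n) set topology" where
  "zariski = topology_generated_by
     {{line z | z. z \<noteq> 0 \<and> f z \<noteq> 0} | f d. f \<in> forms d}"

text \<open>The Zariski topology of \<open>\<A>\<^sup>m \<times> \<P>\<^sup>n\<^sup>-\<^sup>1\<close>, which is finer than the product topology.\<close>

definition rel_zariski :: "(('k::field_char_0 ^ 'm) \<times> ('k ^ 'n) set) topology" where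
  "rel_zariski = topology_generated_by
     {{(t, line z) | t z. z \<noteq> 0 \<and> f (t, z) \<noteq> 0} | f d. f \<in> rel_forms d}"

section \<open>Regular maps\<close>

text \<open>A map between projective varieties is regular if locally it is given by forms of one common
  degree without common zeros.\<close>

definition regular_map ::
  "('k::field_char_0 ^ 'n) set set \<Rightarrow> ('k ^ 'l) set set \<Rightarrow>
   (('k ^ 'n) set \<Rightarrow> ('k ^ 'l) set) \<Rightarrow> bool" where
  "regular_map X Y \<phi> \<longleftrightarrow> \<phi> \<in> X \<rightarrow> Y \<and>
     (\<forall>L\<in>X. \<exists>U d f. openin zariski U \<and> L \<in> U \<and> (\<forall>i. f i \<in> forms d) \<and>
        (\<forall>z. z \<noteq> 0 \<and> line z \<in> X \<inter> U \<longrightarrow>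
           (\<chi> i. f i z) \<noteq> 0 \<and> \<phi> (line z) = line (\<chi> i. f i z)))"

definition variety_iso ::
  "('k::field_char_0 ^ 'n) set set \<Rightarrow> ('k ^ 'l) set set \<Rightarrow>
   (('k ^ 'n) set \<Rightarrow> ('k ^ 'l) set) \<Rightarrow> bool" where
  "variety_iso X Y \<phi> \<longleftrightarrow> regular_map X Y \<phi> \<and>
     (\<exists>\<theta>. regular_map Y X \<theta> \<and> (\<forall>L\<in>X. \<theta> (\<phi> L) = L) \<and> (\<forall>M\<in>Y. \<phi> (\<theta> M) = M))"

text \<open>Regular maps \<open>\<A>\<^sup>m \<times> X \<rightarrow> Y\<close>, in curried form.\<close>

definition rel_regular_map ::
  "('k::field_char_0 ^ 'n) set set \<Rightarrow> ('k ^ 'l) set set \<Rightarrow>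
   ('k ^ 'm \<Rightarrow> ('k ^ 'n) set \<Rightarrow> ('k ^ 'l) set) \<Rightarrow> bool" where
  "rel_regular_map X Y \<alpha> \<longleftrightarrow> (\<forall>t. \<alpha> t \<in> X \<rightarrow> Y) \<and>
     (\<forall>s. \<forall>L\<in>X. \<exists>U d f. openin rel_zariski U \<and> (s, L) \<in> U \<and> (\<forall>i. f i \<in> rel_forms d) \<and>
        (\<forall>t z. z \<noteq> 0 \<and> line z \<in> X \<and> (t, line z) \<in> U \<longrightarrow>
           (\<chi> i. f i (t, z)) \<noteq> 0 \<and> \<alpha> t (line z) = line (\<chi> i. f i (t, z))))"

section \<open>Additive actions and their equivalence\<close>

text \<open>The group \<open>\<G>\<^sub>a\<^sup>m\<close> is the additive group of \<open>K\<^sup>m\<close>. The notion is meant for irreducible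
  \<open>X\<close> of dimension \<open>CARD('m)\<close>. Only the values of an action on \<open>X\<close> matter.\<close>

definition additive_action ::
  "('k::field_char_0 ^ 'n) set set \<Rightarrow> ('k ^ 'm \<Rightarrow> ('k ^ 'n) set \<Rightarrow> ('k ^ 'n) set) \<Rightarrow> bool" where
  "additive_action X \<alpha> \<longleftrightarrow>
     rel_regular_map X X \<alpha> \<and>
     (\<forall>L\<in>X. \<alpha> 0 L = L) \<and>
     (\<forall>s t. \<forall>L\<in>X. \<alpha> (s + t) L = \<alpha> s (\<alpha> t L)) \<and>
     (\<exists>L\<in>X. openin (subtopology zariski X) (range (\<lambda>t. \<alpha> t L)))"

definition equivariantly_isomorphic ::
  "('k::field_char_0 ^ 'n) set set \<Rightarrow> ('k ^ 'm \<Rightarrow> ('k ^ 'n) set \<Rightarrow> ('k ^ 'n) set) \<Rightarrow>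
   ('k ^ 'l) set set \<Rightarrow> ('k ^ 'm \<Rightarrow> ('k ^ 'l) set \<Rightarrow> ('k ^ 'l) set) \<Rightarrow> bool" where
  "equivariantly_isomorphic X \<alpha> Y \<beta> \<longleftrightarrow>
     (\<exists>\<phi>. variety_iso X Y \<phi> \<and> (\<forall>t. \<forall>L\<in>X. \<phi> (\<alpha> t L) = \<beta> t (\<phi> L)))"

definition Ga_automorphism :: "('k::field_char_0 ^ 'm \<Rightarrow> 'k ^ 'm) \<Rightarrow> bool" where
  "Ga_automorphism \<psi> \<longleftrightarrow> bij \<psi> \<and> (\<forall>s t. \<psi> (s + t) = \<psi> s + \<psi> t) \<and>
     (\<forall>i. (\<lambda>t. \<psi> t $ i) \<in> affine_polys) \<and> (\<forall>i. (\<lambda>t. inv \<psi> t $ i) \<in> affine_polys)"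

text \<open>In the classification of additive actions, the acting group is usually identified with
  \<open>\<G>\<^sub>a\<^sup>m\<close> only up to an automorphism of algebraic groups. This relation is coarser than
  \<^const>\<open>equivariantly_isomorphic\<close>.\<close>

definition equivariantly_isomorphic_upto_aut ::
  "('k::field_char_0 ^ 'n) set set \<Rightarrow> ('k ^ 'm \<Rightarrow> ('k ^ 'n) set \<Rightarrow> ('k ^ 'n) set) \<Rightarrow>
   ('k ^ 'l) set set \<Rightarrow> ('k ^ 'm \<Rightarrow> ('k ^ 'l) set \<Rightarrow> ('k ^ 'l) set) \<Rightarrow> bool" where
  "equivariantly_isomorphic_upto_aut X \<alpha> Y \<beta> \<longleftrightarrow>
     (\<exists>\<psi>. Ga_automorphism \<psi> \<and> equivariantly_isomorphic X \<alpha> Y (\<lambda>t. \<beta> (\<psi> t)))"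

definition additive_actions ::
  "('k::field_char_0 ^ 'n) set set \<Rightarrow> ('k ^ 'm \<Rightarrow> ('k ^ 'n) set \<Rightarrow> ('k ^ 'n) set) set" where
  "additive_actions X = {\<alpha>. additive_action X \<alpha>}"

definition strict_equivalence ::
  "('k::field_char_0 ^ 'n) set set \<Rightarrow> ('k ^ 'm \<Rightarrow> ('k ^ 'n) set \<Rightarrow> ('k ^ 'n) set) rel" where
  "strict_equivalence X = {(\<alpha>, \<beta>). \<alpha> \<in> additive_actions X \<and> \<beta> \<in> additive_actions X \<and>
     equivariantly_isomorphic X \<alpha> X \<beta>}"

definition equivalence_upto_aut ::
  "('k::field_char_0 ^ 'n) set set \<Rightarrow> ('k ^ 'm \<Rightarrow> ('k ^ 'n) set \<Rightarrow> ('k ^ 'n) set) rel" where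
  "equivalence_upto_aut X = {(\<alpha>, \<beta>). \<alpha> \<in> additive_actions X \<and> \<beta> \<in> additive_actions X \<and>
     equivariantly_isomorphic_upto_aut X \<alpha> X \<beta>}"

section \<open>Quadrics\<close>

text \<open>\<open>X\<close> is a quadric \<open>Q(n, k)\<close>, the zero locus in \<open>\<P>\<^sup>n\<^sup>+\<^sup>1\<close> of the quadratic form of a
  symmetric matrix of rank \<open>k\<close>.\<close>

definition is_quadric :: "nat \<Rightarrow> nat \<Rightarrow> ('k::field_char_0 ^ 'n) set set \<Rightarrow> bool" where
  "is_quadric n k X \<longleftrightarrow> CARD('n) = n + 2 \<and>
     (\<exists>A :: 'k ^ 'n ^ 'n. transpose A = A \<and> rank A = k \<and>
        X = {line z | z. z \<noteq> 0 \<and> (\<Sum>i\<in>UNIV. \<Sum>j\<in>UNIV. A $ i $ j * z $ i * z $ j) = 0})"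

end

theory Submission
  imports Defs
begin

text \<open>Additive actions on a quadric come from commutative local algebras: if \<open>A\<close> is such an algebra of
dimension 6 with maximal ideal \<open>m\<close>, and \<open>U\<close> is a hyperplane of \<open>m\<close> that generates \<open>A\<close>, then
\<open>exp U\<close> acts on the closure of the orbit of \<open>1\<close> in \<open>\<P>(A)\<close>. For \<open>Q(4,4)\<close> there is a one-parameter
family of suitable algebras. The algebra \<open>A\<^sub>c\<close> has a basis \<open>1, p, q, s, g, h\<close>, and for \<open>v = ap + bq\<close> its
multiplication is given by
\<open>v\<^sup>2 = 2(a\<^sup>2 + 2(c - 1)ab - cb\<^sup>2) s + 2(2ab - b\<^sup>2) g\<close>, \<open>vs = bh\<close>, \<open>vg = (a - cb)h\<close>,
all other products of basis elements from \<open>m\<close> being zero. It is associative because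
\<open>v\<^sup>3 = 6ab(a - b)h\<close> comes from a symmetric trilinear form. The group is \<open>U = \<langle>p, q, g, h\<rangle>\<close>, and the
orbit of \<open>1\<close> has as closure a quadric of rank 4, provided that \<open>c\<^sup>2 - c + 1 \<noteq> 0\<close>. Over an
algebraically closed field every quadric of rank 4 is of this form in suitable coordinates
(lemma \<open>quadric_frame\<close>), so all these actions live on one \<open>X\<close> (\<open>additive_action_act\<close>).

The parameter \<open>c\<close> is a cross-ratio. On the quotient \<open>U / \<langle>g, h\<rangle>\<close>, a plane with coordinates \<open>a, b\<close>, there are
four lines: the zeros \<open>a = 0\<close>, \<open>b = 0\<close>, \<open>a = b\<close> of the cubic form \<open>v\<^sup>3\<close>, and the annihilator \<open>a = cb\<close> of \<open>g\<close>.
They can be recovered from the action as a group acting by homeomorphisms. The one-parameter subgroup in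
the direction \<open>u\<close> moves the point \<open>[1]\<close> to the limit \<open>[u\<^sup>k]\<close>, where \<open>k\<close> is the last exponent with
\<open>u\<^sup>k \<noteq> 0\<close>. If \<open>u\<^sup>3 \<noteq> 0\<close>, then the limit is the fixed point \<open>[h]\<close> (\<open>generic_direction_limit\<close>); if
\<open>u\<^sup>3 = 0\<close>, and \<open>u\<close> is not a multiple of \<open>h\<close>, then it is not fixed by the group
(\<open>special_direction_limit\<close>). For \<open>u\<close> in \<open>\<langle>g, h\<rangle>\<close> a limit in the boundary that is not fixed has the stabilizer
\<open>a = cb\<close> (\<open>ideal_direction_limit\<close>). An equivariant isomorphism, up to a linear automorphism of the group,
respects limits and stabilizers. Hence it induces a linear map of the planes that permutes the three zeros
and maps the fourth line to the fourth line (\<open>special_hyperplanes_permuted\<close>), so that \<open>c\<close> and \<open>c'\<close>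
agree up to the six transformations of the cross-ratio. These identify no two distinct integers
\<open>c, c' \<ge> 3\<close>, which yields infinitely many classes for both notions of equivalence.\<close>

no_notation fps_nth (infixl "$" 75)

section \<open>Polynomial functions\<close>

lemma polynomial_functions_uminus:
  "f \<in> polynomial_functions C \<Longrightarrow> (\<lambda>p. - f p) \<in> polynomial_functions C"
  using polynomial_functions.mult[OF polynomial_functions.const[of "-1"], of f C] by simp

lemma polynomial_functions_diff:
  "f \<in> polynomial_functions C \<Longrightarrow> g \<in> polynomial_functions C \<Longrightarrow>
    (\<lambda>p. f p - g p) \<in> polynomial_functions C"
  using polynomial_functions.add[of f C "\<lambda>p. - g p"] polynomial_functions_uminus[of g C] by simp

lemma polynomial_functions_power:
  "f \<in> polynomial_functions C \<Longrightarrow> (\<lambda>p. f p ^ n) \<in> polynomial_functions C"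
  by (induction n) (auto intro: polynomial_functions.intros)

lemma polynomial_functions_sum:
  "(\<And>i. i \<in> S \<Longrightarrow> f i \<in> polynomial_functions C) \<Longrightarrow>
    (\<lambda>p. \<Sum>i\<in>S. f i p) \<in> polynomial_functions C"
  by (induction S rule: infinite_finite_induct) (auto intro: polynomial_functions.intros)

lemmas polynomial_functions_intros = polynomial_functions.const polynomial_functions.add
  polynomial_functions.mult polynomial_functions_uminus polynomial_functions_diff
  polynomial_functions_power polynomial_functions_sum

lemma polynomial_functions_compose:
  assumes "f \<in> polynomial_functions C" "\<And>h. h \<in> C \<Longrightarrow> (\<lambda>p. h (g p)) \<in> polynomial_functions D"
  shows "(\<lambda>p. f (g p)) \<in> polynomial_functions D"
  using assms by induction (auto intro: polynomial_functions_intros)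

text \<open>Stated for an arbitrary source, since it is applied to maps between affine spaces and also to polynomial
curves, where the coordinates generate the polynomial functions in one variable.\<close>
lemma affine_polys_compose:
  assumes "f \<in> affine_polys" "\<And>i. (\<lambda>p. g p $ i) \<in> polynomial_functions D"
  shows "(\<lambda>p. f (g p)) \<in> polynomial_functions D"
  using assms unfolding affine_polys_def by (auto intro: polynomial_functions_compose)

lemma affine_polys_compose_affine:
  assumes "f \<in> affine_polys" "\<And>i. (\<lambda>z. g z $ i) \<in> affine_polys"
  shows "(\<lambda>z. f (g z)) \<in> affine_polys"
  using assms unfolding affine_polys_def by (rule affine_polys_compose[unfolded affine_polys_def])

lemma affine_polys_coord: "(\<lambda>z. z $ i) \<in> affine_polys"
  unfolding affine_polys_def by (auto intro: polynomial_functions.coord)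

lemma affine_polys_matrix: "(\<lambda>z. (R *v z) $ i) \<in> affine_polys"
  unfolding affine_polys_def matrix_vector_mult_def
  by (auto intro!: polynomial_functions_intros intro: polynomial_functions.coord)

lemma univariate_polynomial_function:
  assumes "f \<in> polynomial_functions {\<lambda>x. x}"
  shows "\<exists>p. \<forall>x. f x = poly p x"
  using assms
proof induction
  case (const c) show ?case by (rule exI[of _ "[:c:]"]) simp
next
  case (coord f) then show ?case by (intro exI[of _ "[:0,1:]"]) simp
next
  case (add f g) then show ?case by (metis poly_add)
next
  case (mult f g) then show ?case by (metis poly_mult)
qed

section \<open>Limits in the Zariski topology\<close>

lemma line_alt: "line z = range (\<lambda>k. k *s z)"
  unfolding line_def by (auto simp: vec.span_singleton)

lemma line_eq_iff:
  assumes "z \<noteq> 0" shows "line z = line w \<longleftrightarrow> (\<exists>k. k \<noteq> 0 \<and> w = k *s z)"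
proof
  assume *: "line z = line w"
  have refl: "y \<in> line y" for y :: "'a ^ 'b" unfolding line_alt by (rule range_eqI[of _ _ 1]) simp
  have "w \<in> line z" unfolding * by (rule refl)
  then obtain k where k: "w = k *s z" unfolding line_alt by blast
  have "z \<in> line w" unfolding *[symmetric] by (rule refl)
  then have "k \<noteq> 0" using k assms unfolding line_alt by auto
  then show "\<exists>k. k \<noteq> 0 \<and> w = k *s z" using k by blast
next
  assume "\<exists>k. k \<noteq> 0 \<and> w = k *s z"
  then obtain k where k: "k \<noteq> 0" "w = k *s z" by auto
  then have "j *s z = (j / k) *s w" "j *s w = (j * k) *s z" for j by (simp_all add: vector_smult_assoc)
  then show "line z = line w" unfolding line_alt by blast
qed

lemma image_line:
  assumes "\<And>k z. g (k *s z) = k *s g z"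
  shows "g ` line z = line (g z)"
  unfolding line_alt by (simp add: image_image assms)

lemma formsI:
  "f \<in> affine_polys \<Longrightarrow> (\<And>c z. f (c *s z) = c ^ d * f z) \<Longrightarrow> f \<in> forms d"
  unfolding forms_def by auto

lemma forms_scale: "f \<in> forms d \<Longrightarrow> f (c *s z) = c ^ d * f z"
  unfolding forms_def by auto

lemma forms_const: "(\<lambda>_. c) \<in> forms 0"
  unfolding forms_def affine_polys_def by (auto intro: polynomial_functions.const)

lemma form_nonzero_on_line:
  "f \<in> forms d \<Longrightarrow> z \<noteq> 0 \<Longrightarrow> line z = line w \<Longrightarrow> f w \<noteq> 0 \<longleftrightarrow> f z \<noteq> 0"
  by (auto simp: line_eq_iff forms_scale)

lemma openin_zariski_nonzero:
  "f \<in> forms d \<Longrightarrow> openin zariski {line z | z. z \<noteq> 0 \<and> f z \<noteq> 0}"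
  unfolding zariski_def openin_topology_generated_by_iff
  by (auto intro!: generate_topology_on.Basis)

lemma openin_zariski_lines: "openin zariski {line z | z. z \<noteq> 0}"
  using openin_zariski_nonzero[OF forms_const[of 1]] by simp

text \<open>The complements of the zero sets of forms are only a subbasis by definition, but a limit may be tested on
a subbasis, because eventual membership passes to finite intersections and to unions.\<close>
lemma limitin_zariski_iff:
  assumes "w \<noteq> 0"
  shows "limitin zariski c (line w) G \<longleftrightarrow>
    (\<forall>d. \<forall>f \<in> forms d. f w \<noteq> 0 \<longrightarrow> (\<forall>\<^sub>F t in G. \<exists>z. c t = line z \<and> z \<noteq> 0 \<and> f z \<noteq> 0))"
    (is "?L \<longleftrightarrow> ?R")
proof
  assume L: ?L
  show ?R
  proof (intro allI ballI impI)
    fix d f assume f: "f \<in> forms d" "f w \<noteq> 0"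
    have "\<forall>\<^sub>F t in G. c t \<in> {line z | z. z \<noteq> 0 \<and> f z \<noteq> 0}"
      using L openin_zariski_nonzero[OF f(1)] f(2) assms unfolding limitin_def by blast
    then show "\<forall>\<^sub>F t in G. \<exists>z. c t = line z \<and> z \<noteq> 0 \<and> f z \<noteq> 0"
      by eventually_elim auto
  qed
next
  assume R: ?R
  have "\<forall>\<^sub>F t in G. c t \<in> U" if "openin zariski U" "line w \<in> U" for U
    using that unfolding zariski_def openin_topology_generated_by_iff
  proof induction
    case (Int a b) then show ?case by (auto intro: eventually_conj)
  next
    case (UN K)
    then obtain k where "k \<in> K" "line w \<in> k" by auto
    with UN have "\<forall>\<^sub>F t in G. c t \<in> k" by auto
    then show ?case by eventually_elim (use \<open>k \<in> K\<close> in auto)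
  next
    case (Basis s)
    then obtain f d where f: "s = {line z | z. z \<noteq> 0 \<and> f z \<noteq> 0}" "f \<in> forms d" by auto
    obtain z where z: "line w = line z" "z \<noteq> 0" "f z \<noteq> 0" using Basis.prems unfolding f(1) by blast
    have "f w \<noteq> 0" using form_nonzero_on_line[OF f(2) z(2) z(1)[symmetric]] z(3) by simp
    then have "\<forall>\<^sub>F t in G. \<exists>z. c t = line z \<and> z \<noteq> 0 \<and> f z \<noteq> 0" using R f(2) by blast
    then show ?case unfolding f(1) by eventually_elim blast
  qed auto
  moreover have "line w \<in> topspace zariski"
    using openin_subset[OF openin_zariski_lines] assms by blast
  ultimately show ?L unfolding limitin_def by blast
qed

text \<open>On a curve the proper closed sets are finite, so that limits of curves are taken along the cofinite
filter. Such limits are not unique, as every point of the curve is a limit too, but all of them lie in every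
closed set that contains the curve.\<close>
lemma form_zero_at_limit:
  fixes \<gamma> :: "'k::field_char_0 \<Rightarrow> 'k ^ 'n"
  assumes lim: "limitin zariski (\<lambda>t. line (\<gamma> t)) (line w) cofinite" and w: "w \<noteq> 0"
    and f: "f \<in> forms d" and zero: "\<And>t. f (\<gamma> t) = 0" and nz: "\<And>t. \<gamma> t \<noteq> 0"
  shows "f w = 0"
proof (rule ccontr)
  assume "f w \<noteq> 0"
  then have "\<forall>\<^sub>F t in cofinite. \<exists>z. line (\<gamma> t) = line z \<and> z \<noteq> 0 \<and> f z \<noteq> 0"
    using lim w f by (auto simp: limitin_zariski_iff)
  then have "\<forall>\<^sub>F t::'k in cofinite. False"
    by eventually_elim (use form_nonzero_on_line[OF f] zero in metis)
  then show False by (simp add: infinite_UNIV_char_0)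
qed

text \<open>The curve \<open>\<delta>\<close> is the given curve near infinity, in the coordinate \<open>1/t\<close>. A form that does not vanish at
\<open>\<delta> 0\<close> is a nonzero polynomial along \<open>\<delta>\<close> and has only finitely many zeros there.\<close>
lemma limitin_polynomial_curve:
  fixes \<delta> :: "'k::field_char_0 \<Rightarrow> 'k ^ 'n"
  assumes poly: "\<And>i. (\<lambda>x. \<delta> x $ i) \<in> polynomial_functions {\<lambda>x. x}"
    and nz: "\<And>x. \<delta> x \<noteq> 0" and c: "\<And>t. t \<noteq> 0 \<Longrightarrow> c t = line (\<delta> (inverse t))"
  shows "limitin zariski c (line (\<delta> 0)) cofinite"
  unfolding limitin_zariski_iff[OF nz]
proof (intro allI ballI impI)
  fix d and f :: "'k ^ 'n \<Rightarrow> 'k" assume f: "f \<in> forms d" "f (\<delta> 0) \<noteq> 0"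
  then have "(\<lambda>x. f (\<delta> x)) \<in> polynomial_functions {\<lambda>x. x}"
    by (auto intro: affine_polys_compose[where g = \<delta>] poly simp: forms_def)
  then obtain p where p: "\<And>x. f (\<delta> x) = poly p x" using univariate_polynomial_function by blast
  then have "p \<noteq> 0" using f by auto
  then have "finite {x. poly p x = 0}" by (rule poly_roots_finite)
  then have "finite (insert 0 (inverse ` {x. poly p x = 0}))" by simp
  moreover have "{t. \<not> (\<exists>z. c t = line z \<and> z \<noteq> 0 \<and> f z \<noteq> 0)} \<subseteq> insert 0 (inverse ` {x. poly p x = 0})"
  proof
    fix t assume t: "t \<in> {t. \<not> (\<exists>z. c t = line z \<and> z \<noteq> 0 \<and> f z \<noteq> 0)}"
    show "t \<in> insert 0 (inverse ` {x. poly p x = 0})"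
    proof (cases "t = 0")
      case False
      then have "poly p (inverse t) = 0" using t c[OF False] nz p by auto
      then have "inverse (inverse t) \<in> inverse ` {x. poly p x = 0}" by blast
      then show ?thesis by simp
    qed simp
  qed
  ultimately show "\<forall>\<^sub>F t in cofinite. \<exists>z. c t = line z \<and> z \<noteq> 0 \<and> f z \<noteq> 0"
    unfolding eventually_cofinite by (rule finite_subset[rotated])
qed

text \<open>Regular maps are continuous: locally the pullback of a form of degree \<open>e\<close> under a map given by forms of degree
\<open>d\<close> is a form of degree \<open>d * e\<close>.\<close>
lemma regular_map_limit:
  fixes \<phi> :: "('k::field_char_0 ^ 'n) set \<Rightarrow> ('k ^ 'l) set"
  assumes \<phi>: "regular_map X Y \<phi>" and X: "X \<subseteq> {line z | z. z \<noteq> 0}" and M: "M \<in> X" and c: "\<And>t. c t \<in> X"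
    and lim: "limitin zariski c M G"
  shows "limitin zariski (\<lambda>t. \<phi> (c t)) (\<phi> M) G"
proof -
  obtain w where w: "M = line w" "w \<noteq> 0" using X M by auto
  have "\<exists>U d f. openin zariski U \<and> M \<in> U \<and> (\<forall>i. f i \<in> forms d) \<and>
        (\<forall>z. z \<noteq> 0 \<and> line z \<in> X \<inter> U \<longrightarrow>
           (\<chi> i. f i z) \<noteq> 0 \<and> \<phi> (line z) = line (\<chi> i. f i z))"
    using \<phi> M unfolding regular_map_def by (elim conjE) (rule bspec)
  then obtain U d f where U: "openin zariski U \<and> M \<in> U" and f: "\<forall>i. f i \<in> forms d"
    and loc: "\<forall>z. z \<noteq> 0 \<and> line z \<in> X \<inter> U \<longrightarrow>
           (\<chi> i. f i z) \<noteq> 0 \<and> \<phi> (line z) = line (\<chi> i. f i z)"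
    by (elim exE conjE) (rule that, rule conjI)
  let ?f = "\<lambda>z. \<chi> i. f i z"
  have "w \<noteq> 0 \<and> line w \<in> X \<inter> U" using M U w by simp
  from loc[rule_format, OF this] have fw: "?f w \<noteq> 0" "\<phi> M = line (?f w)" unfolding w(1) by simp_all
  show ?thesis unfolding fw(2) limitin_zariski_iff[OF fw(1)]
  proof (intro allI ballI impI)
    fix e and g :: "'k ^ 'l \<Rightarrow> 'k" assume g: "g \<in> forms e" "g (?f w) \<noteq> 0"
    have "(\<lambda>z. g (?f z)) \<in> affine_polys"
      using f g by (intro affine_polys_compose_affine[where g = ?f and f = g]) (auto simp: forms_def)
    moreover have "g (?f (k *s z)) = k ^ (d * e) * g (?f z)" for k z
    proof -
      have "?f (k *s z) = k ^ d *s ?f z" using f by (simp add: vec_eq_iff forms_scale)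
      then show ?thesis using g by (simp add: forms_scale power_mult)
    qed
    ultimately have gf: "(\<lambda>z. g (?f z)) \<in> forms (d * e)" by (rule formsI)
    have "\<forall>\<^sub>F t in G. \<exists>z. c t = line z \<and> z \<noteq> 0 \<and> g (?f z) \<noteq> 0"
      by (rule lim[unfolded w(1) limitin_zariski_iff[OF w(2)], rule_format, OF gf g(2)])
    moreover have "\<forall>\<^sub>F t in G. c t \<in> U" using lim U unfolding limitin_def by blast
    ultimately show "\<forall>\<^sub>F t in G. \<exists>y. \<phi> (c t) = line y \<and> y \<noteq> 0 \<and> g y \<noteq> 0"
    proof eventually_elim
      case (elim t)
      then obtain z where z: "c t = line z" "z \<noteq> 0" "g (?f z) \<noteq> 0" by blast
      have "z \<noteq> 0 \<and> line z \<in> X \<inter> U" using elim(2) c[of t] z(2) unfolding z(1) by simp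
      from loc[rule_format, OF this] show ?case unfolding z(1)
        by (intro exI[of _ "?f z"]) (simp add: z(3))
    qed
  qed
qed

section \<open>Coordinates adapted to a quadric of rank 4\<close>

definition matrix_form :: "'k::field ^ 'n ^ 'n \<Rightarrow> 'k ^ 'n \<Rightarrow> 'k ^ 'n \<Rightarrow> 'k" where
  "matrix_form A x y = (\<Sum>i\<in>UNIV. \<Sum>j\<in>UNIV. A $ i $ j * x $ i * y $ j)"

definition dot :: "'k::field ^ 'n \<Rightarrow> 'k ^ 'n \<Rightarrow> 'k" where
  "dot x y = (\<Sum>i\<in>UNIV. x $ i * y $ i)"

lemma matrix_form_dot: "matrix_form A x y = dot x (A *v y)"
  unfolding matrix_form_def dot_def matrix_vector_mult_def
  by (simp add: sum_distrib_left mult.assoc mult.left_commute)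

lemma dot_linear:
  "dot (x + y) z = dot x z + dot y z" "dot (x - y) z = dot x z - dot y z"
  "dot (k *s x) z = k * dot x z" "dot 0 z = 0" "dot z 0 = 0"
  unfolding dot_def by (simp_all add: sum.distrib sum_subtractf sum_distrib_left algebra_simps)

lemma dot_commute: "dot x y = dot y x"
  unfolding dot_def by (simp add: mult.commute)

lemma dot_sum: "dot (\<Sum>i\<in>S. f i) z = (\<Sum>i\<in>S. dot (f i) z)"
  by (induction S rule: infinite_finite_induct) (auto simp: dot_linear)

lemma matrix_form_commute: "transpose A = A \<Longrightarrow> matrix_form A x y = matrix_form A y x"
  unfolding matrix_form_def
  by (subst sum.swap) (auto simp: transpose_def vec_eq_iff mult.commute mult.left_commute intro!: sum.cong)

lemma dot_nondegenerate: assumes "\<And>x. dot x y = 0" shows "y = 0"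
proof -
  have "y $ i = 0" for i using assms[of "axis i 1"] unfolding dot_def axis_def
    by (simp add: if_distrib[of "\<lambda>x. x * _"] cong: if_cong)
  then show ?thesis by (simp add: vec_eq_iff)
qed

lemma square_root_exists: "\<exists>y::'k::alg_closed_field. y ^ 2 = x"
  by (metis nth_root_exists zero_less_numeral)

text \<open>Applying \<open>dot _ v\<close> to a linear relation between the vectors \<open>A *v w\<close> isolates the coefficient at
\<open>v\<close>.\<close>
lemma orthonormal_independent:
  fixes A :: "'k::field ^ 'n ^ 'n"
  assumes orth: "\<And>v w. v \<in> S \<Longrightarrow> w \<in> S \<Longrightarrow> matrix_form A v w = (if v = w then 1 else 0)"
  shows "vec.independent ((*v) A ` S)" "inj_on ((*v) A) S"
proof -
  show inj: "inj_on ((*v) A) S"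
  proof (rule inj_onI)
    fix v w assume vw: "v \<in> S" "w \<in> S" "A *v v = A *v w"
    have "matrix_form A v v = matrix_form A v w" unfolding matrix_form_dot vw(3) ..
    then show "v = w" using orth vw by (auto split: if_splits)
  qed
  show "vec.independent ((*v) A ` S)"
  proof
    assume "vec.dependent ((*v) A ` S)"
    then obtain U u where U: "finite U" "U \<subseteq> (*v) A ` S" "(\<Sum>v\<in>U. u v *s v) = 0" "\<exists>v\<in>U. u v \<noteq> 0"
      unfolding vec.dependent_explicit by blast
    then obtain v where v: "v \<in> S" "A *v v \<in> U" "u (A *v v) \<noteq> 0" by blast
    have "0 = dot (\<Sum>w\<in>U. u w *s w) v" by (simp add: U(3) dot_linear)
    also have "\<dots> = (\<Sum>w\<in>U. u w * dot w v)" by (simp add: dot_sum dot_linear)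
    also have "\<dots> = (\<Sum>w\<in>U. if w = A *v v then u w else 0)"
    proof (rule sum.cong)
      fix w assume w: "w \<in> U"
      then obtain x where x: "x \<in> S" "w = A *v x" using U(2) by blast
      then have "dot w v = matrix_form A v x" by (simp add: matrix_form_dot dot_commute)
      moreover have "w = A *v v \<longleftrightarrow> x = v"
        using inj_on_eq_iff[OF inj x(1) v(1)] unfolding x(2) by simp
      ultimately show "u w * dot w v = (if w = A *v v then u w else 0)"
        using orth[OF v(1) x(1)] by simp
    qed simp
    also have "\<dots> = u (A *v v)" using U(1) v(2) by simp
    finally show False using v by simp
  qed
qed

lemma matrix_form_linear:
  "matrix_form A (x + y) z = matrix_form A x z + matrix_form A y z" "matrix_form A (x - y) z = matrix_form A x z - matrix_form A y z"
  "matrix_form A (k *s x) z = k * matrix_form A x z" "matrix_form A (\<Sum>i\<in>S. f i) z = (\<Sum>i\<in>S. matrix_form A (f i) z)"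
  by (simp_all add: matrix_form_dot dot_linear dot_sum)

text \<open>A maximal orthonormal family works. If the quadratic form of \<open>A\<close> were not the sum of squares, then the
component of some \<open>x\<close> orthogonal to the family would not be isotropic; divided by a square root of its
value, it would enlarge the family.\<close>
lemma orthonormal_maximal:
  fixes A :: "'k::alg_closed_field ^ 'n ^ 'n"
  assumes sym: "transpose A = A"
  obtains S where "finite S" "\<And>v w. v \<in> S \<Longrightarrow> w \<in> S \<Longrightarrow> matrix_form A v w = (if v = w then 1 else 0)"
    "\<And>x. matrix_form A x x = (\<Sum>v\<in>S. matrix_form A x v ^ 2)"
proof -
  define P where "P S \<longleftrightarrow> finite S \<and> (\<forall>v\<in>S. \<forall>w\<in>S. matrix_form A v w = (if v = w then 1 else 0))" for S
  have bound: "card S \<le> CARD('n)" if "P S" for S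
  proof -
    have orth: "matrix_form A v w = (if v = w then 1 else 0)" if "v \<in> S" "w \<in> S" for v w
      using \<open>P S\<close> that unfolding P_def by blast
    have "card S = card ((*v) A ` S)"
      using orthonormal_independent(2)[OF orth] by (simp add: card_image)
    also have "\<dots> \<le> vec.dim (UNIV :: ('k ^ 'n) set)"
      using orthonormal_independent(1)[OF orth] by (intro vec.independent_card_le_dim) auto
    finally show ?thesis by (simp add: card_cart_basis)
  qed
  have "P {}" unfolding P_def by simp
  then obtain S where S: "P S" and max: "\<And>T. P T \<Longrightarrow> card T \<le> card S"
    using ex_has_greatest_nat[of P "{}" card "CARD('n) + 1"] bound by (auto simp: less_Suc_eq_le)
  have fin: "finite S" and orth: "\<And>v w. v \<in> S \<Longrightarrow> w \<in> S \<Longrightarrow> matrix_form A v w = (if v = w then 1 else 0)"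
    using S unfolding P_def by auto
  note com = matrix_form_commute[OF sym]
  have "matrix_form A x x = (\<Sum>v\<in>S. matrix_form A x v ^ 2)" for x
  proof (rule ccontr)
    assume neq: "matrix_form A x x \<noteq> (\<Sum>v\<in>S. matrix_form A x v ^ 2)"
    define y where "y = x - (\<Sum>v\<in>S. matrix_form A x v *s v)"
    have y0: "matrix_form A y w = 0" if w: "w \<in> S" for w
    proof -
      have "(\<Sum>v\<in>S. matrix_form A x v * matrix_form A v w) = (\<Sum>v\<in>S. if v = w then matrix_form A x v else 0)"
        using orth w by (intro sum.cong) auto
      also have "\<dots> = matrix_form A x w" using fin w by simp
      finally show ?thesis unfolding y_def by (simp add: matrix_form_linear)
    qed
    have "matrix_form A y y = matrix_form A x y - (\<Sum>v\<in>S. matrix_form A x v * matrix_form A v y)"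
      by (subst y_def) (simp add: matrix_form_linear)
    also have "(\<Sum>v\<in>S. matrix_form A x v * matrix_form A v y) = 0"
      using y0 by (intro sum.neutral ballI) (metis com mult_zero_right)
    also have "matrix_form A x y = matrix_form A y x" by (rule com)
    also have "matrix_form A y x = matrix_form A x x - (\<Sum>v\<in>S. matrix_form A x v * matrix_form A v x)"
      unfolding y_def by (simp add: matrix_form_linear)
    also have "(\<Sum>v\<in>S. matrix_form A x v * matrix_form A v x) = (\<Sum>v\<in>S. matrix_form A x v ^ 2)"
      by (rule sum.cong) (auto simp: power2_eq_square com[of x])
    finally have yy: "matrix_form A y y \<noteq> 0" using neq by simp
    obtain r where r: "r ^ 2 = matrix_form A y y" using square_root_exists by blast
    define u where "u = inverse r *s y"
    have r0: "r \<noteq> 0" using r yy by auto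
    have u0: "matrix_form A u w = 0" if "w \<in> S" for w
      unfolding u_def using y0[OF that] by (simp add: matrix_form_linear)
    have "matrix_form A u u = inverse r * (inverse r * matrix_form A y y)"
      unfolding u_def by (simp only: matrix_form_linear com[of y "inverse r *s y"])
    then have uu: "matrix_form A u u = 1" using r0 unfolding r[symmetric] by (simp add: field_simps power2_eq_square)
    then have "u \<notin> S" using u0 by auto
    moreover have "P (insert u S)" unfolding P_def
      using fin orth u0 uu com \<open>u \<notin> S\<close> by (metis finite_insert insert_iff)
    ultimately show False using max[of "insert u S"] fin by simp
  qed
  with fin orth show thesis by (rule that)
qed

text \<open>Polarization turns the sum of squares into an expression of \<open>A *v x\<close> by the vectors \<open>A *v v\<close>, which
therefore are a basis of the column space.\<close>
lemma orthonormal_card_rank: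
  fixes A :: "'k::field_char_0 ^ 'n ^ 'n"
  assumes sym: "transpose A = A"
    and orth: "\<And>v w. v \<in> S \<Longrightarrow> w \<in> S \<Longrightarrow> matrix_form A v w = (if v = w then 1 else 0)"
    and sq: "\<And>x. matrix_form A x x = (\<Sum>v\<in>S. matrix_form A x v ^ 2)"
  shows "card S = rank A"
proof -
  note com = matrix_form_commute[OF sym]
  have polar: "matrix_form A x y = (\<Sum>v\<in>S. matrix_form A x v * matrix_form A y v)" for x y
  proof -
    have "matrix_form A (x + y) (x + y) = matrix_form A x x + 2 * matrix_form A x y + matrix_form A y y"
      by (simp add: matrix_form_linear com[of x "x + y"] com[of y "x + y"] com[of y x])
    also have "matrix_form A (x + y) (x + y)
        = matrix_form A x x + 2 * (\<Sum>v\<in>S. matrix_form A x v * matrix_form A y v) + matrix_form A y y"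
      unfolding sq by (simp add: matrix_form_linear power2_sum sum.distrib sum_distrib_left mult.assoc)
    finally show ?thesis by simp
  qed
  have image: "A *v x = (\<Sum>v\<in>S. matrix_form A x v *s (A *v v))" for x
  proof -
    have "dot y (A *v x - (\<Sum>v\<in>S. matrix_form A x v *s (A *v v))) = 0" for y
      using polar[of y x]
      by (simp add: dot_commute[of y] dot_linear dot_sum)
         (simp add: dot_commute[of _ y] flip: matrix_form_dot add: mult.commute)
    then show ?thesis using dot_nondegenerate by (metis (no_types, lifting) eq_iff_diff_eq_0)
  qed
  have rows: "rows A = columns A" using sym by (metis rows_transpose)
  have "vec.span ((*v) A ` S) = vec.span (columns A)"
  proof (rule vec.span_eq[THEN iffD2], intro conjI subsetI)
    fix y assume "y \<in> (*v) A ` S"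
    then obtain v where "y = A *v v" by auto
    moreover have "column i A \<in> vec.span (columns A)" for i
      by (rule vec.span_base) (auto simp: columns_def)
    ultimately show "y \<in> vec.span (columns A)"
      unfolding matrix_mult_sum by (auto intro: vec.span_sum vec.span_scale)
  next
    fix y assume "y \<in> columns A"
    then obtain i where "y = column i A" unfolding columns_def by auto
    then have "y = A *v axis i 1"
      by (simp add: column_def vec_eq_iff matrix_vector_mult_def axis_def if_distrib cong: if_cong)
    also have "\<dots> = (\<Sum>v\<in>S. matrix_form A (axis i 1) v *s (A *v v))" by (rule image)
    finally show "y \<in> vec.span ((*v) A ` S)"
      by (simp, intro vec.span_sum vec.span_scale vec.span_base imageI)
  qed
  then have "vec.dim (columns A) = card ((*v) A ` S)"
    using orthonormal_independent(1)[OF orth] by (intro vec.dim_eq_card) auto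
  also have "\<dots> = card S"
    using orthonormal_independent(2)[OF orth] by (simp add: card_image)
  finally show ?thesis unfolding row_rank_def_gen rows by simp
qed

lemma exhaust_6: "x = 1 \<or> x = 2 \<or> x = 3 \<or> x = 4 \<or> x = 5 \<or> x = 6" for x :: 6
proof (induct x)
  case (of_int z)
  then have "z = 0 \<or> z = 1 \<or> z = 2 \<or> z = 3 \<or> z = 4 \<or> z = 5"
    by simp linarith
  then show ?case by auto
qed

lemma forall_6: "(\<forall>i::6. P i) \<longleftrightarrow> P 1 \<and> P 2 \<and> P 3 \<and> P 4 \<and> P 5 \<and> P 6"
  by (metis exhaust_6)

lemma vector_6:
  "(vector [a,b,c,d,e,f] :: 'k::zero ^ 6) $ 1 = a" "(vector [a,b,c,d,e,f] :: 'k ^ 6) $ 2 = b"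
  "(vector [a,b,c,d,e,f] :: 'k ^ 6) $ 3 = c" "(vector [a,b,c,d,e,f] :: 'k ^ 6) $ 4 = d"
  "(vector [a,b,c,d,e,f] :: 'k ^ 6) $ 5 = e" "(vector [a,b,c,d,e,f] :: 'k ^ 6) $ 6 = f"
  by (simp_all add: vector_def)

text \<open>The form \<open>x\<^sub>1 x\<^sub>4 - Q(x\<^sub>2, x\<^sub>3)\<close>, where \<open>Q(a, b) = a\<^sup>2 + 2(c - 1)ab - cb\<^sup>2\<close> has the discriminant
\<open>c\<^sup>2 - c + 1\<close> up to a constant factor. It depends on \<open>c\<close> to let the cubic form \<open>ab(a - b)\<close> of the action below
be independent of \<open>c\<close>.\<close>
definition quadric_form :: "'k::field_char_0 \<Rightarrow> 'k ^ 6 \<Rightarrow> 'k" where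
  "quadric_form c x = x $ 1 * x $ 4 - (x $ 2 ^ 2 + 2 * (c - 1) * x $ 2 * x $ 3 - c * x $ 3 ^ 2)"

lemma extend_independent:
  fixes T :: "('k::field ^ 'n) set"
  assumes "vec.independent T" "card T < CARD('n)"
  obtains w where "w \<notin> T" "vec.independent (insert w T)"
proof -
  have "vec.span T \<noteq> UNIV"
  proof
    assume "vec.span T = UNIV"
    then have "vec.dim (UNIV :: ('k ^ 'n) set) = card T"
      using assms(1) vec.dim_span_eq_card_independent by metis
    then show False using assms(2) by (simp add: card_cart_basis)
  qed
  then obtain w where "w \<notin> vec.span T" by blast
  moreover from this have "w \<notin> T" using vec.span_base by blast
  ultimately show thesis using that assms(1) vec.independent_insertI by blast
qed

text \<open>The four squares \<open>l\<^sub>1\<^sup>2 + l\<^sub>2\<^sup>2 + l\<^sub>3\<^sup>2 + l\<^sub>4\<^sup>2\<close> are grouped into \<open>(l\<^sub>1 + i l\<^sub>2)(l\<^sub>1 - i l\<^sub>2)\<close> and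
\<open>l\<^sub>3\<^sup>2 + l\<^sub>4\<^sup>2 = - Q(a, b)\<close>. The latter follows from \<open>Q(a, b) = (a + (c - 1)b)\<^sup>2 - (c\<^sup>2 - c + 1) b\<^sup>2\<close>. Two further
independent linear forms \<open>l\<^sub>5, l\<^sub>6\<close> complete the coordinates.\<close>
lemma quadric_frame:
  fixes A :: "'k::{alg_closed_field, field_char_0} ^ 6 ^ 6"
  assumes sym: "transpose A = A" and rank: "rank A = 4" and c: "c ^ 2 - c + 1 \<noteq> 0"
  obtains R where "invertible R" "\<And>z. matrix_form A z z = quadric_form c (R *v z)"
proof -
  obtain S where fin: "finite S"
    and orth: "\<And>v w. v \<in> S \<Longrightarrow> w \<in> S \<Longrightarrow> matrix_form A v w = (if v = w then 1 else 0)"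
    and sq: "\<And>x. matrix_form A x x = (\<Sum>v\<in>S. matrix_form A x v ^ 2)"
    using orthonormal_maximal[OF sym] by blast
  have card: "card S = 4" using orthonormal_card_rank[OF sym orth sq] rank by simp
  define T where "T = (*v) A ` S"
  have T: "vec.independent T" "card T = 4"
    using orthonormal_independent[OF orth] card unfolding T_def by (simp_all add: card_image)
  obtain l1 l2 l3 l4 where l: "T = {l1, l2, l3, l4}" "distinct [l1, l2, l3, l4]"
    using T(2) by (auto simp: card_Suc_eq numeral_eq_Suc)
  obtain l5 where l5: "l5 \<notin> T" "vec.independent (insert l5 T)"
    using extend_independent[OF T(1)] T(2) by auto
  obtain l6 where l6: "l6 \<notin> insert l5 T" "vec.independent (insert l6 (insert l5 T))"
    using extend_independent[OF l5(2)] T l5(1) l by auto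
  have "card (insert l6 (insert l5 T)) = 6" using l l5(1) l6(1) by auto
  then have "UNIV \<subseteq> vec.span (insert l6 (insert l5 T))"
    using l6(2) by (intro vec.card_ge_dim_independent) (simp_all add: card_cart_basis)
  then have span: "vec.span (insert l6 (insert l5 T)) = UNIV" by blast
  have A_sq: "matrix_form A z z = dot l1 z ^ 2 + dot l2 z ^ 2 + dot l3 z ^ 2 + dot l4 z ^ 2" for z
  proof -
    have "matrix_form A z z = (\<Sum>v\<in>S. dot (A *v v) z ^ 2)"
      unfolding sq by (simp add: matrix_form_dot dot_commute)
    also have "\<dots> = (\<Sum>y\<in>T. dot y z ^ 2)"
      unfolding T_def using orthonormal_independent(2)[OF orth] by (simp add: sum.reindex)
    also have "\<dots> = dot l1 z ^ 2 + dot l2 z ^ 2 + dot l3 z ^ 2 + dot l4 z ^ 2"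
      unfolding l(1) using l(2) by (simp add: add.assoc)
    finally show ?thesis .
  qed
  obtain i :: 'k where i: "i ^ 2 = -1" using square_root_exists by blast
  obtain r where r: "r ^ 2 = c ^ 2 - c + 1" using square_root_exists by blast
  have r0: "r \<noteq> 0" and i0: "i \<noteq> 0" using r c i by auto
  \<comment> \<open>The rows satisfy \<open>x\<^sub>2 + (c - 1) x\<^sub>3 = i l\<^sub>3\<close> and \<open>r x\<^sub>3 = l\<^sub>4\<close>.\<close>
  define R :: "'k ^ 6 ^ 6" where "R = vector [l1 + i *s l2,
      i *s l3 - ((c - 1) / r) *s l4, inverse r *s l4, l1 - i *s l2, l5, l6]"
  have R: "(R *v z) $ j = dot (R $ j) z" for z j
    unfolding matrix_vector_mult_def dot_def by simp
  have comp: "(R *v z) $ 1 = dot l1 z + i * dot l2 z"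
     "(R *v z) $ 2 = i * dot l3 z - (c - 1) / r * dot l4 z" "(R *v z) $ 3 = dot l4 z / r"
     "(R *v z) $ 4 = dot l1 z - i * dot l2 z" "(R *v z) $ 5 = dot l5 z"
     "(R *v z) $ 6 = dot l6 z" for z
    unfolding R by (simp_all add: R_def vector_6 dot_linear divide_inverse mult.commute)
  have "z = 0" if z: "R *v z = 0" for z
  proof -
    have zero: "dot l1 z + i * dot l2 z = 0" "i * dot l3 z - (c - 1) / r * dot l4 z = 0"
      "dot l4 z / r = 0" "dot l1 z - i * dot l2 z = 0" "dot l5 z = 0" "dot l6 z = 0"
      unfolding comp[symmetric] z by simp_all
    have l4: "dot l4 z = 0" using zero(3) r0 by simp
    have l3: "dot l3 z = 0" using zero(2) i0 l4 by simp
    have "2 * dot l1 z = 0" using zero(1,4) by (simp add: algebra_simps)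
    then have l1: "dot l1 z = 0" by simp
    then have l2: "dot l2 z = 0" using zero(1) i0 by simp
    have "dot y z = 0" if "y \<in> vec.span (insert l6 (insert l5 T))" for y
      using that
    proof (induction rule: vec.span_induct_alt)
      case base then show ?case by (simp add: dot_linear)
    next
      case (step k x y)
      then have "x \<in> {l6, l5, l1, l2, l3, l4}" unfolding l(1) by blast
      then show ?case using step l1 l2 l3 l4 zero(5,6) by (auto simp: dot_linear)
    qed
    then show "z = 0" unfolding span using dot_nondegenerate by blast
  qed
  then have "invertible R"
    unfolding invertible_left_inverse matrix_left_invertible_ker by blast
  moreover have "matrix_form A z z = quadric_form c (R *v z)" for z
  proof -
    have "(i * dot l3 z - (c - 1) / r * dot l4 z) ^ 2
        + 2 * (c - 1) * (i * dot l3 z - (c - 1) / r * dot l4 z) * (dot l4 z / r)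
        - c * (dot l4 z / r) ^ 2
      = (i * dot l3 z) ^ 2 - (c ^ 2 - c + 1) * (dot l4 z / r) ^ 2"
      by (simp add: divide_inverse) algebra
    also have "\<dots> = - (dot l3 z ^ 2) - dot l4 z ^ 2"
      unfolding r[symmetric] power_mult_distrib i using r0 by (simp add: power_divide)
    finally have "quadric_form c (R *v z) = (dot l1 z + i * dot l2 z) * (dot l1 z - i * dot l2 z)
        + dot l3 z ^ 2 + dot l4 z ^ 2"
      unfolding quadric_form_def comp by (simp add: algebra_simps)
    also have "(dot l1 z + i * dot l2 z) * (dot l1 z - i * dot l2 z) = dot l1 z ^ 2 - i ^ 2 * dot l2 z ^ 2"
      by algebra
    finally show ?thesis unfolding A_sq i by simp
  qed
  ultimately show thesis by (rule that)
qed

section \<open>A family of additive actions\<close>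

text \<open>Multiplication by \<open>exp(u)\<close> in the algebra \<open>A\<^sub>c\<close> with respect to the basis \<open>1, p, q, s, g, h\<close>, where
\<open>u = t\<^sub>1 p + t\<^sub>2 q + t\<^sub>3 g + t\<^sub>4 h\<close>.\<close>
definition exp_act :: "'k::field_char_0 \<Rightarrow> 'k ^ 4 \<Rightarrow> 'k ^ 6 \<Rightarrow> 'k ^ 6" where
  "exp_act c t x = vector
    [x $ 1,
     x $ 2 + t $ 1 * x $ 1,
     x $ 3 + t $ 2 * x $ 1,
     x $ 4 + 2 * (t $ 1 * x $ 2 + (c - 1) * (t $ 1 * x $ 3 + t $ 2 * x $ 2) - c * t $ 2 * x $ 3)
       + x $ 1 * (t $ 1 ^ 2 + 2 * (c - 1) * t $ 1 * t $ 2 - c * t $ 2 ^ 2),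
     x $ 5 + 2 * (t $ 1 * x $ 3 + t $ 2 * x $ 2 - t $ 2 * x $ 3)
       + x $ 1 * (t $ 3 + 2 * t $ 1 * t $ 2 - t $ 2 ^ 2),
     x $ 6 + (t $ 1 - c * t $ 2) * x $ 5 + t $ 2 * x $ 4
       + (x $ 2 - c * x $ 3) * (t $ 3 + 2 * t $ 1 * t $ 2 - t $ 2 ^ 2)
       + x $ 3 * (t $ 1 ^ 2 + 2 * (c - 1) * t $ 1 * t $ 2 - c * t $ 2 ^ 2)
       + x $ 1 * (t $ 4 + (t $ 1 - c * t $ 2) * t $ 3 + t $ 1 * t $ 2 * (t $ 1 - t $ 2))]"

lemma vec6_eq_iff: "x = y \<longleftrightarrow> x $ 1 = y $ 1 \<and> x $ 2 = y $ 2 \<and> x $ 3 = y $ 3 \<and> x $ 4 = y $ 4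
    \<and> x $ 5 = y $ 5 \<and> x $ 6 = y $ 6" for x y :: "'k ^ 6"
  by (simp add: vec_eq_iff forall_6)

lemma exp_act_zero: "exp_act c 0 x = x"
  by (simp add: vec6_eq_iff exp_act_def vector_6)

lemma exp_act_add: "exp_act c (s + t) x = exp_act c s (exp_act c t x)"
  unfolding vec6_eq_iff exp_act_def vector_6 vector_add_component
  by (intro conjI; simp add: algebra_simps power2_eq_square)

lemma exp_act_scale: "exp_act c t (k *s x) = k *s exp_act c t x"
  unfolding vec6_eq_iff exp_act_def vector_6 vector_smult_component
  by (intro conjI; simp add: algebra_simps power2_eq_square)

lemma quadric_form_exp_act: "quadric_form c (exp_act c t x) = quadric_form c x"
  unfolding quadric_form_def exp_act_def vector_6 by (simp add: algebra_simps power2_eq_square)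

lemma exp_act_eq_0_iff: "exp_act c t x = 0 \<longleftrightarrow> x = 0"
proof -
  have "exp_act c (- t) (exp_act c t x) = x"
    by (simp add: exp_act_zero flip: exp_act_add)
  moreover have "exp_act c s 0 = 0" for s using exp_act_scale[of c s 0 0] by simp
  ultimately show ?thesis by metis
qed

text \<open>The unit element of the algebra.\<close>
definition basepoint :: "'k::field_char_0 ^ 6" where "basepoint = vector [1, 0, 0, 0, 0, 0]"

lemma basepoint_nonzero: "basepoint \<noteq> 0"
  by (simp add: vec6_eq_iff basepoint_def vector_6)

lemma exp_act_basepoint:
  "exp_act c t basepoint = vector
    [1, t $ 1, t $ 2, t $ 1 ^ 2 + 2 * (c - 1) * t $ 1 * t $ 2 - c * t $ 2 ^ 2,
     t $ 3 + 2 * t $ 1 * t $ 2 - t $ 2 ^ 2,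
     t $ 4 + (t $ 1 - c * t $ 2) * t $ 3 + t $ 1 * t $ 2 * (t $ 1 - t $ 2)]"
  by (simp add: vec6_eq_iff exp_act_def basepoint_def vector_6)

text \<open>The inverse of the orbit map, which is a logarithm: \<open>t\<^sub>1, t\<^sub>2, t\<^sub>3, t\<^sub>4\<close> are found successively, and the
equation of the quadric takes care of the fourth coordinate.\<close>
lemma exp_act_transitive:
  assumes "quadric_form c x = 0" "x $ 1 \<noteq> 0"
  obtains t where "x = x $ 1 *s exp_act c t basepoint"
proof -
  define a b where "a = x $ 2 / x $ 1" and "b = x $ 3 / x $ 1"
  define z where "z = x $ 5 / x $ 1 - 2 * a * b + b ^ 2"
  define t :: "'a ^ 4" where "t = vector [a, b, z, x $ 6 / x $ 1 - (a - c * b) * z - a * b * (a - b)]"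
  have ab: "x $ 2 = x $ 1 * a" "x $ 3 = x $ 1 * b" using assms(2) by (simp_all add: a_def b_def)
  have t: "t $ 1 = a" "t $ 2 = b" "t $ 3 = z" "t $ 4 = x $ 6 / x $ 1 - (a - c * b) * z - a * b * (a - b)"
    by (simp_all add: t_def vector_def)
  have "x $ 1 * x $ 4 = x $ 1 * (x $ 1 * (a ^ 2 + 2 * (c - 1) * a * b - c * b ^ 2))"
    using assms(1) unfolding quadric_form_def ab by algebra
  then have x4: "x $ 4 = x $ 1 * (a ^ 2 + 2 * (c - 1) * a * b - c * b ^ 2)"
    using assms(2) by simp
  have "x = x $ 1 *s exp_act c t basepoint"
    unfolding vec6_eq_iff exp_act_basepoint vector_smult_component vector_6 t
    using assms(2) x4 by (simp add: ab z_def)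
  then show thesis by (rule that)
qed

lemma exp_act_boundary:
  assumes "x $ 1 = 0" "t $ 1 = 0" "t $ 2 = 0" "t $ 3 = 0"
  shows "exp_act c t x = x"
  using assms by (simp add: vec6_eq_iff exp_act_def vector_6)

lemma exp_act_polynomial:
  assumes "\<And>j. (\<lambda>p. t p $ j) \<in> polynomial_functions C" "\<And>j. (\<lambda>p. x p $ j) \<in> polynomial_functions C"
  shows "(\<lambda>p. exp_act c (t p) (x p) $ i) \<in> polynomial_functions C"
proof -
  have "\<forall>i. (\<lambda>p. exp_act c (t p) (x p) $ i) \<in> polynomial_functions C"
    unfolding forall_6 exp_act_def vector_6
    by (intro conjI polynomial_functions_intros assms)
  then show ?thesis by blast
qed

lemma matrix_polynomial:
  assumes "\<And>j. (\<lambda>p. x p $ j) \<in> polynomial_functions C"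
  shows "(\<lambda>p. (R *v x p) $ i) \<in> polynomial_functions C"
  unfolding matrix_vector_mult_def by (auto intro!: polynomial_functions_intros assms)

text \<open>A quadric \<open>X\<close> with a matrix \<open>R\<close> of adapted coordinates. The inverse \<open>P\<close> of \<open>R\<close> is a parameter as well, to
have a formula for the action on \<open>X\<close>.\<close>
locale quadric_frame_action =
  fixes c :: "'k::field_char_0" and R P :: "'k ^ 6 ^ 6" and X :: "('k ^ 6) set set"
  assumes inverse: "P ** R = mat 1"
    and X_eq: "X = {line z | z. z \<noteq> 0 \<and> quadric_form c (R *v z) = 0}"
begin

definition point :: "'k ^ 6 \<Rightarrow> ('k ^ 6) set" where "point x = line (P *v x)"

definition act :: "'k ^ 4 \<Rightarrow> ('k ^ 6) set \<Rightarrow> ('k ^ 6) set" where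
  "act t L = (\<lambda>z. P *v exp_act c t (R *v z)) ` L"

lemma PR: "P *v (R *v z) = z" and RP: "R *v (P *v z) = z"
  using inverse matrix_left_right_inverse[of P R]
  by (simp_all add: matrix_vector_mul_assoc)

lemma P_eq_0_iff: "P *v x = 0 \<longleftrightarrow> x = 0" and R_eq_0_iff: "R *v x = 0 \<longleftrightarrow> x = 0"
  by (metis RP matrix_vector_mult_0_right, metis PR matrix_vector_mult_0_right)

lemma act_line: "act t (line z) = line (P *v exp_act c t (R *v z))"
  unfolding act_def by (rule image_line) (simp add: vector_scalar_commute exp_act_scale)

lemma act_point: "act t (point x) = point (exp_act c t x)"
  unfolding point_def act_line RP ..

lemma X_lines: "X \<subseteq> {line z | z. z \<noteq> 0}"
  unfolding X_eq by blast

lemma point_in_X: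
  assumes "x \<noteq> 0" "quadric_form c x = 0" shows "point x \<in> X"
  unfolding X_eq point_def using assms
  by (intro CollectI exI[of _ "P *v x"]) (simp add: P_eq_0_iff RP)

lemma X_cases:
  assumes "L \<in> X" obtains x where "L = point x" "x \<noteq> 0" "quadric_form c x = 0"
proof -
  obtain z where "L = line z" "z \<noteq> 0" "quadric_form c (R *v z) = 0"
    using assms unfolding X_eq by blast
  then show thesis using that[of "R *v z"] by (simp add: point_def PR R_eq_0_iff)
qed

lemma point_eq_iff:
  assumes "x \<noteq> 0" shows "point x = point y \<longleftrightarrow> (\<exists>k. k \<noteq> 0 \<and> y = k *s x)"
proof -
  have "P *v y = k *s (P *v x) \<longleftrightarrow> y = k *s x" for k
    by (metis RP vector_scalar_commute)
  then show ?thesis unfolding point_def using assms by (simp add: line_eq_iff P_eq_0_iff)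
qed

lemma act_in_X: "L \<in> X \<Longrightarrow> act t L \<in> X"
  by (elim X_cases) (auto simp: act_point intro!: point_in_X simp: exp_act_eq_0_iff quadric_form_exp_act)

lemma act_zero: "L \<in> X \<Longrightarrow> act 0 L = L"
  by (elim X_cases) (simp add: act_point exp_act_zero)

lemma act_add: "L \<in> X \<Longrightarrow> act (s + t) L = act s (act t L)"
  by (elim X_cases) (simp add: act_point exp_act_add)

lemma form_pullback:
  assumes "f \<in> forms d" shows "(\<lambda>z. f (R *v z)) \<in> forms d"
proof (rule formsI)
  show "(\<lambda>z. f (R *v z)) \<in> affine_polys"
    by (rule affine_polys_compose_affine[where g = "\<lambda>z. R *v z"])
      (use assms affine_polys_matrix in \<open>auto simp: forms_def\<close>)
  show "f (R *v (k *s z)) = k ^ d * f (R *v z)" for k z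
    using assms by (simp add: vector_scalar_commute forms_scale)
qed

text \<open>Forms of degree 1 in the point describe the action globally, so that one chart suffices. It is the
nonvanishing locus of the constant form 1 of degree 0.\<close>
lemma act_rel_regular: "rel_regular_map X X act"
  unfolding rel_regular_map_def
proof (intro conjI allI ballI)
  show "act t \<in> X \<rightarrow> X" for t using act_in_X by blast
  fix s L assume L: "L \<in> X"
  let ?U = "{(t, line z) | (t :: 'k ^ 4) (z :: 'k ^ 6). z \<noteq> 0 \<and> (\<lambda>_. 1) (t, z) \<noteq> (0::'k)}"
  let ?f = "\<lambda>i (t, z). (P *v exp_act c t (R *v z)) $ i"
  have one: "(\<lambda>_. 1) \<in> (rel_forms 0 :: (('k ^ 4) \<times> ('k ^ 6) \<Rightarrow> 'k) set)"
    unfolding rel_forms_def by (auto intro: polynomial_functions.const)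
  have U: "openin rel_zariski ?U"
    unfolding rel_zariski_def openin_topology_generated_by_iff
    by (rule generate_topology_on.Basis, rule CollectI, rule exI[of _ "\<lambda>_. 1"], rule exI[of _ 0],
        rule conjI[OF _ one]) (rule refl)
  have "(s, L) \<in> ?U" using L X_lines by auto
  moreover have "?f i \<in> rel_forms 1" for i
  proof -
    let ?C = "range (\<lambda>i p. fst p $ i) \<union> range (\<lambda>j p. snd p $ j)
      :: (('k ^ 4) \<times> ('k ^ 6) \<Rightarrow> 'k) set"
    have z: "(\<lambda>p. snd p $ j) \<in> polynomial_functions ?C"
      and t: "(\<lambda>p. fst p $ i) \<in> polynomial_functions ?C" for i j
      by (rule polynomial_functions.coord; blast)+
    have "(\<lambda>p. (P *v exp_act c (fst p) (R *v snd p)) $ i) \<in> polynomial_functions ?C"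
      by (intro matrix_polynomial exp_act_polynomial) (rule t z)+
    then show ?thesis
      unfolding rel_forms_def case_prod_unfold by (simp add: vector_scalar_commute exp_act_scale)
  qed
  moreover have "(\<chi> i. ?f i (t, z)) = P *v exp_act c t (R *v z)" for t z
    by (simp add: vec_eq_iff)
  then have "\<forall>t z. z \<noteq> 0 \<and> line z \<in> X \<and> (t, line z) \<in> ?U \<longrightarrow>
           (\<chi> i. ?f i (t, z)) \<noteq> 0 \<and> act t (line z) = line (\<chi> i. ?f i (t, z))"
    by (simp add: act_line P_eq_0_iff R_eq_0_iff exp_act_eq_0_iff)
  ultimately show "\<exists>U d f. openin rel_zariski U \<and> (s, L) \<in> U \<and> (\<forall>i. f i \<in> rel_forms d) \<and>
        (\<forall>t z. z \<noteq> 0 \<and> line z \<in> X \<and> (t, line z) \<in> U \<longrightarrow>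
           (\<chi> i. f i (t, z)) \<noteq> 0 \<and> act t (line z) = line (\<chi> i. f i (t, z)))"
    using U by (intro exI[of _ ?U] exI[of _ 1] exI[of _ ?f]) blast
qed

lemma act_regular: "regular_map X X (act t)"
  unfolding regular_map_def
proof (intro conjI ballI)
  show "act t \<in> X \<rightarrow> X" using act_in_X by blast
  fix L assume L: "L \<in> X"
  let ?f = "\<lambda>i z. (P *v exp_act c t (R *v z)) $ i"
  have "?f i \<in> forms 1" for i
  proof (rule formsI)
    have "(\<lambda>z. z $ j) \<in> polynomial_functions (range (\<lambda>i t. t $ i))" for j
      by (rule polynomial_functions.coord) blast
    then show "?f i \<in> affine_polys" unfolding affine_polys_def
      by (intro matrix_polynomial exp_act_polynomial) (rule polynomial_functions.const)+
  qed (simp add: vector_scalar_commute exp_act_scale)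
  moreover have "(\<chi> i. ?f i z) = P *v exp_act c t (R *v z)" for z
    by (simp add: vec_eq_iff)
  then have "\<forall>z. z \<noteq> 0 \<and> line z \<in> X \<inter> {line z |z. z \<noteq> 0} \<longrightarrow>
           (\<chi> i. ?f i z) \<noteq> 0 \<and> act t (line z) = line (\<chi> i. ?f i z)"
    by (simp add: act_line P_eq_0_iff R_eq_0_iff exp_act_eq_0_iff)
  moreover have "L \<in> {line z |z. z \<noteq> 0}" using L X_lines by blast
  ultimately show "\<exists>U d f. openin zariski U \<and> L \<in> U \<and> (\<forall>i. f i \<in> forms d) \<and>
        (\<forall>z. z \<noteq> 0 \<and> line z \<in> X \<inter> U \<longrightarrow>
           (\<chi> i. f i z) \<noteq> 0 \<and> act t (line z) = line (\<chi> i. f i z))"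
    using openin_zariski_lines
    by (intro exI[of _ "{line z |z. z \<noteq> 0}"] exI[of _ 1] exI[of _ ?f]) blast
qed

abbreviation origin where "origin \<equiv> point basepoint"

lemma origin_in_X: "origin \<in> X"
  by (rule point_in_X) (simp_all add: basepoint_nonzero, simp add: quadric_form_def basepoint_def vector_6)

text \<open>Invertible elements of the algebra are those with a nonzero coefficient at 1, and \<open>exp U\<close> acts transitively
on their classes in the quadric.\<close>
lemma point_in_orbit_iff:
  assumes "x \<noteq> 0" "quadric_form c x = 0"
  shows "point x \<in> range (\<lambda>t. act t origin) \<longleftrightarrow> x $ 1 \<noteq> 0"
proof
  assume "point x \<in> range (\<lambda>t. act t origin)"
  then obtain t where "point x = point (exp_act c t basepoint)" by (auto simp: act_point)
  then obtain k where "k \<noteq> 0" "exp_act c t basepoint = k *s x" using assms by (auto simp: point_eq_iff)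
  then have "k * x $ 1 = 1" by (metis exp_act_basepoint vector_6(1) vector_smult_component)
  then show "x $ 1 \<noteq> 0" by auto
next
  assume x1: "x $ 1 \<noteq> 0"
  obtain t where "x = x $ 1 *s exp_act c t basepoint" using exp_act_transitive[OF assms(2) x1] .
  then have "point (exp_act c t basepoint) = point x"
    using x1 by (subst point_eq_iff) (auto simp: exp_act_eq_0_iff basepoint_nonzero)
  then show "point x \<in> range (\<lambda>t. act t origin)" by (auto simp: act_point)
qed

lemma additive_action_act: "additive_action X act"
  unfolding additive_action_def
proof (intro conjI ballI allI)
  show "rel_regular_map X X act" by (rule act_rel_regular)
  show "act 0 L = L" if "L \<in> X" for L using that by (rule act_zero)
  show "act (s + t) L = act s (act t L)" if "L \<in> X" for s t L using that by (rule act_add)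
  have "(\<lambda>z. (R *v z) $ 1) \<in> forms 1"
    by (rule formsI) (simp_all add: affine_polys_matrix vector_scalar_commute)
  from openin_zariski_nonzero[OF this] have
    "openin (subtopology zariski X) ({line z | z. z \<noteq> 0 \<and> (R *v z) $ 1 \<noteq> 0} \<inter> X)"
    unfolding openin_subtopology by blast
  also have "{line z | z. z \<noteq> 0 \<and> (R *v z) $ 1 \<noteq> 0} \<inter> X = range (\<lambda>t. act t origin)"
  proof (intro equalityI subsetI)
    fix L assume "L \<in> {line z | z. z \<noteq> 0 \<and> (R *v z) $ 1 \<noteq> 0} \<inter> X"
    then obtain z where z: "L = line z" "z \<noteq> 0" "(R *v z) $ 1 \<noteq> 0" "L \<in> X" by blast
    have Lz: "L = point (R *v z)" unfolding point_def PR z(1) ..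
    obtain x where x: "L = point x" "x \<noteq> 0" "quadric_form c x = 0" using X_cases[OF z(4)] .
    obtain k where "R *v z = k *s x" using point_eq_iff[OF x(2)] Lz x(1) by auto
    then have "x $ 1 \<noteq> 0" using z(3) by auto
    then show "L \<in> range (\<lambda>t. act t origin)" using point_in_orbit_iff[OF x(2,3)] x(1) by simp
  next
    fix L assume L: "L \<in> range (\<lambda>t. act t origin)"
    then have LX: "L \<in> X" using act_in_X origin_in_X by blast
    obtain x where x: "L = point x" "x \<noteq> 0" "quadric_form c x = 0" using X_cases[OF LX] .
    then have "x $ 1 \<noteq> 0" using L point_in_orbit_iff by blast
    then show "L \<in> {line z | z. z \<noteq> 0 \<and> (R *v z) $ 1 \<noteq> 0} \<inter> X"
      using LX x by (auto simp: point_def P_eq_0_iff RP intro!: exI[of _ "P *v x"])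
  qed
  finally show "\<exists>L\<in>X. openin (subtopology zariski X) (range (\<lambda>t. act t L))"
    using origin_in_X by blast
qed

section \<open>Limits of one-parameter subgroups\<close>

lemma orbit_stabilizer_trivial:
  assumes "act t (act s origin) = act s origin" shows "t = 0"
proof -
  have "act (- s) (act t (act s origin)) = act (- s) (act s origin)" using assms by simp
  then have "act (- s + (t + s)) origin = act (- s + s) origin"
    by (simp only: act_add[OF origin_in_X])
  then have "point basepoint = point (exp_act c t basepoint)"
    by (simp add: act_zero[OF origin_in_X]) (simp add: act_point)
  then obtain k where k: "exp_act c t basepoint = k *s basepoint"
    using point_eq_iff[OF basepoint_nonzero] by blast
  have "k = 1" "t $ 1 = 0" "t $ 2 = 0"
    using arg_cong[OF k, of "\<lambda>x. x $ 1"] arg_cong[OF k, of "\<lambda>x. x $ 2"] arg_cong[OF k, of "\<lambda>x. x $ 3"]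
    unfolding exp_act_basepoint by (simp_all add: basepoint_def vector_6)
  moreover from this have "t $ 3 = 0" "t $ 4 = 0"
    using arg_cong[OF k, of "\<lambda>x. x $ 5"] arg_cong[OF k, of "\<lambda>x. x $ 6"]
    unfolding exp_act_basepoint by (simp_all add: basepoint_def vector_6)
  ultimately show "t = 0" by (simp add: vec_eq_iff forall_4)
qed

text \<open>The direction \<open>h\<close> is annihilated by the maximal ideal, so that it acts trivially on the boundary, whereas
the open orbit is free. This recognizes the open orbit from the stabilizers alone.\<close>
lemma boundary_iff_stabilizer:
  assumes "L \<in> X"
  shows "L \<notin> range (\<lambda>t. act t origin) \<longleftrightarrow> (\<exists>t. t \<noteq> 0 \<and> act t L = L)"
proof
  assume L: "L \<notin> range (\<lambda>t. act t origin)"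
  obtain x where x: "L = point x" "x \<noteq> 0" "quadric_form c x = 0" using X_cases[OF assms] .
  then have x1: "x $ 1 = 0" using L point_in_orbit_iff by blast
  let ?t = "axis 4 1 :: 'k ^ 4"
  have "exp_act c ?t x = x" using x1 by (intro exp_act_boundary) (simp_all add: axis_def)
  moreover have "?t \<noteq> 0" by (simp add: axis_eq_0_iff)
  ultimately show "\<exists>t. t \<noteq> 0 \<and> act t L = L" unfolding x(1) act_point by metis
next
  assume "\<exists>t. t \<noteq> 0 \<and> act t L = L"
  then show "L \<notin> range (\<lambda>t. act t origin)" using orbit_stabilizer_trivial by blast
qed

lemma boundary_point:
  assumes "M \<in> X" "M \<notin> range (\<lambda>t. act t origin)"
  obtains x where "M = point x" "x \<noteq> 0" "x $ 1 = 0"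
  using X_cases[OF assms(1)] point_in_orbit_iff assms(2) by metis

text \<open>On the span of \<open>s, g, h\<close> multiplication by \<open>exp(u)\<close> only adds \<open>ux\<close>, a multiple of \<open>h\<close>. Thus the class of \<open>x\<close> is
fixed by \<open>u\<close> if and only if \<open>ux = 0\<close>.\<close>
lemma stabilizer_of_vertex_plane:
  assumes x: "x \<noteq> 0" "x $ 1 = 0" "x $ 2 = 0" "x $ 3 = 0"
  shows "act t (point x) = point x \<longleftrightarrow> (t $ 1 - c * t $ 2) * x $ 5 + t $ 2 * x $ 4 = 0"
proof -
  have e: "exp_act c t x = vector [0, 0, 0, x $ 4, x $ 5,
      x $ 6 + (t $ 1 - c * t $ 2) * x $ 5 + t $ 2 * x $ 4]"
    using x by (simp add: vec6_eq_iff exp_act_def vector_6)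
  have "act t (point x) = point x \<longleftrightarrow> (\<exists>k. k \<noteq> 0 \<and> exp_act c t x = k *s x)"
    unfolding act_point using point_eq_iff[OF x(1)] by metis
  also have "\<dots> \<longleftrightarrow> (t $ 1 - c * t $ 2) * x $ 5 + t $ 2 * x $ 4 = 0"
  proof
    assume "\<exists>k. k \<noteq> 0 \<and> exp_act c t x = k *s x"
    then obtain k where k: "exp_act c t x = k *s x" by blast
    have *: "x $ 4 = k * x $ 4" "x $ 5 = k * x $ 5"
      "x $ 6 + (t $ 1 - c * t $ 2) * x $ 5 + t $ 2 * x $ 4 = k * x $ 6"
      using k unfolding e by (simp_all add: vec6_eq_iff vector_6)
    show "(t $ 1 - c * t $ 2) * x $ 5 + t $ 2 * x $ 4 = 0"
    proof (cases "x $ 4 = 0 \<and> x $ 5 = 0")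
      case False
      then have "k = 1" using * by auto
      then show ?thesis using *(3) by (simp add: algebra_simps)
    qed simp
  next
    assume "(t $ 1 - c * t $ 2) * x $ 5 + t $ 2 * x $ 4 = 0"
    then have "exp_act c t x = 1 *s x"
      unfolding e using x by (simp add: vec6_eq_iff vector_6 add.assoc)
    then show "\<exists>k. k \<noteq> 0 \<and> exp_act c t x = k *s x" using zero_neq_one by metis
  qed
  finally show ?thesis .
qed

lemma form_zero_at_orbit_limit:
  assumes lim: "limitin zariski (\<lambda>s. act (s *s u) origin) (point x) cofinite" and x: "x \<noteq> 0"
    and f: "f \<in> forms d" and zero: "\<And>s. f (exp_act c (s *s u) basepoint) = 0"
  shows "f x = 0"
proof -
  have "(\<lambda>z. f (R *v z)) (P *v x) = 0"
  proof (rule form_zero_at_limit[OF _ _ form_pullback[OF f]])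
    show "limitin zariski (\<lambda>s. line (P *v exp_act c (s *s u) basepoint)) (line (P *v x)) cofinite"
      using lim unfolding act_point unfolding point_def .
  qed (simp_all add: x P_eq_0_iff RP zero exp_act_eq_0_iff basepoint_nonzero)
  then show ?thesis by (simp add: RP)
qed

lemma orbit_limit_exists:
  fixes \<delta> :: "'k \<Rightarrow> 'k ^ 6"
  assumes poly: "\<And>i. (\<lambda>s. \<delta> s $ i) \<in> polynomial_functions {\<lambda>x. x}" and nz: "\<And>s. \<delta> s \<noteq> 0"
    and eq: "\<And>s. s \<noteq> 0 \<Longrightarrow> exp_act c (s *s u) basepoint = s ^ d *s \<delta> (inverse s)"
  shows "limitin zariski (\<lambda>s. act (s *s u) origin) (point (\<delta> 0)) cofinite"
  unfolding point_def
proof (rule limitin_polynomial_curve[where \<delta> = "\<lambda>s. P *v \<delta> s"])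
  show "(\<lambda>s. (P *v \<delta> s) $ i) \<in> polynomial_functions {\<lambda>x. x}" for i
    by (rule matrix_polynomial) (rule poly)
  show "P *v \<delta> s \<noteq> 0" for s using nz by (simp add: P_eq_0_iff)
  fix s :: 'k assume s: "s \<noteq> 0"
  have "point (\<delta> (inverse s)) = point (exp_act c (s *s u) basepoint)"
    unfolding point_eq_iff[OF nz] eq[OF s] using s by (intro exI[of _ "s ^ d"]) simp
  then show "act (s *s u) (line (P *v basepoint)) = line (P *v \<delta> (inverse s))"
    using act_point unfolding point_def by metis
qed

text \<open>If \<open>u\<^sup>3 = 0\<close>, then the limit is \<open>[u\<^sup>2]\<close>, or \<open>[u]\<close> for \<open>u\<close> in \<open>\<langle>g, h\<rangle>\<close>. It lies in the span of \<open>s, g, h\<close> and differs from the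
only fixed point \<open>[h]\<close>.\<close>
lemma special_direction_limit:
  assumes C: "u $ 1 * u $ 2 * (u $ 1 - u $ 2) = 0" and u: "u $ 1 \<noteq> 0 \<or> u $ 2 \<noteq> 0 \<or> u $ 3 \<noteq> 0"
  obtains M t where "M \<in> X" "limitin zariski (\<lambda>s. act (s *s u) origin) M cofinite"
    "M \<notin> range (\<lambda>t. act t origin)" "act t M \<noteq> M"
proof -
  let ?q = "u $ 1 ^ 2 + 2 * (c - 1) * u $ 1 * u $ 2 - c * u $ 2 ^ 2"
  let ?r = "2 * u $ 1 * u $ 2 - u $ 2 ^ 2" and ?l = "u $ 1 - c * u $ 2"
  have id: "(\<lambda>x. x) \<in> polynomial_functions {\<lambda>x. x :: 'k}" by (rule polynomial_functions.coord) simp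
  have "\<exists>x. x \<noteq> 0 \<and> x $ 1 = 0 \<and> x $ 2 = 0 \<and> x $ 3 = 0 \<and> (x $ 4 \<noteq> 0 \<or> x $ 5 \<noteq> 0) \<and>
    limitin zariski (\<lambda>s. act (s *s u) origin) (point x) cofinite"
  proof (cases "u $ 1 = 0 \<and> u $ 2 = 0")
    case True
    then have u3: "u $ 3 \<noteq> 0" using u by simp
    \<comment> \<open>The line through \<open>[1]\<close> and \<open>[u]\<close>, parametrized by the inverse of the time.\<close>
    define \<delta> :: "'k \<Rightarrow> 'k ^ 6" where "\<delta> s = vector [s, 0, 0, 0, u $ 3, u $ 4]" for s
    have nz: "\<delta> s \<noteq> 0" for s using u3 by (simp add: \<delta>_def vec6_eq_iff vector_6)
    have "\<forall>i. (\<lambda>s. \<delta> s $ i) \<in> polynomial_functions {\<lambda>x. x}"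
      unfolding forall_6 \<delta>_def vector_6 by (intro conjI polynomial_functions_intros id)
    moreover have "exp_act c (s *s u) basepoint = s ^ 1 *s \<delta> (inverse s)" if "s \<noteq> 0" for s
      unfolding exp_act_basepoint vec6_eq_iff vector_6 \<delta>_def vector_smult_component
      using that True by simp
    ultimately have "limitin zariski (\<lambda>s. act (s *s u) origin) (point (\<delta> 0)) cofinite"
      using nz by (intro orbit_limit_exists) blast+
    then show ?thesis using nz[of 0] u3 by (intro exI[of _ "\<delta> 0"]) (simp add: \<delta>_def vector_6)
  next
    case False
    \<comment> \<open>The curve \<open>s\<^sup>2 exp(u / s)\<close>, which is polynomial in \<open>s\<close> because \<open>u\<^sup>3 = 0\<close>.\<close>
    define \<delta> :: "'k \<Rightarrow> 'k ^ 6" where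
      "\<delta> s = vector [s ^ 2, s * u $ 1, s * u $ 2, ?q, s * u $ 3 + ?r, s * u $ 4 + ?l * u $ 3]" for s
    have qr: "?q \<noteq> 0 \<or> ?r \<noteq> 0"
    proof -
      consider "u $ 1 = 0" | "u $ 2 = 0" | "u $ 1 = u $ 2" using C by auto
      then show ?thesis using False by cases (auto simp: power2_eq_square)
    qed
    have "\<delta> s \<noteq> 0" for s
    proof
      assume "\<delta> s = 0"
      then have "\<delta> s $ 1 = 0" "\<delta> s $ 4 = 0" "\<delta> s $ 5 = 0" by simp_all
      then have "s = 0" "?q = 0" "s * u $ 3 + ?r = 0" unfolding \<delta>_def vector_6 by simp_all
      then show False using qr by simp
    qed
    note nz = this
    have "\<forall>i. (\<lambda>s. \<delta> s $ i) \<in> polynomial_functions {\<lambda>x. x}"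
      unfolding forall_6 \<delta>_def vector_6 by (intro conjI polynomial_functions_intros id)
    moreover have "exp_act c (s *s u) basepoint = s ^ 2 *s \<delta> (inverse s)" if "s \<noteq> 0" for s
    proof -
      have "(s * u $ 1) * (s * u $ 2) * (s * u $ 1 - s * u $ 2) = s ^ 3 * (u $ 1 * u $ 2 * (u $ 1 - u $ 2))"
        by algebra
      then have "(s * u $ 1) * (s * u $ 2) * (s * u $ 1 - s * u $ 2) = 0" using C by simp
      then show ?thesis
        unfolding exp_act_basepoint vec6_eq_iff vector_6 \<delta>_def vector_smult_component
        using that by (simp add: field_simps power2_eq_square)
    qed
    ultimately have "limitin zariski (\<lambda>s. act (s *s u) origin) (point (\<delta> 0)) cofinite"
      using nz by (intro orbit_limit_exists) blast+
    then show ?thesis using nz[of 0] qr by (intro exI[of _ "\<delta> 0"]) (simp add: \<delta>_def vector_6)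
  qed
  then obtain x where x: "x \<noteq> 0" "x $ 1 = 0" "x $ 2 = 0" "x $ 3 = 0" "x $ 4 \<noteq> 0 \<or> x $ 5 \<noteq> 0"
    and lim: "limitin zariski (\<lambda>s. act (s *s u) origin) (point x) cofinite" by blast
  have q: "quadric_form c x = 0" using x by (simp add: quadric_form_def)
  have "\<exists>t. act t (point x) \<noteq> point x"
  proof (cases "x $ 5 = 0")
    case True
    then show ?thesis using x
      by (intro exI[of _ "vector [0, 1, 0, 0]"]) (simp add: stabilizer_of_vertex_plane vector_def)
  next
    case False
    then show ?thesis using x
      by (intro exI[of _ "vector [1, 0, 0, 0]"]) (simp add: stabilizer_of_vertex_plane vector_def)
  qed
  then show thesis
    using that[OF point_in_X[OF x(1) q] lim] point_in_orbit_iff[OF x(1) q] x(2) by blast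
qed

text \<open>Suppose \<open>u\<^sup>3 \<noteq> 0\<close>. The curve \<open>exp(su)\<close> is a cubic in \<open>s\<close> whose leading coefficient is at \<open>h\<close>. Eliminating \<open>s\<close>
yields forms that vanish on the curve and force a limit in the boundary to have all coordinates except the last
equal to zero. This is the fixed point \<open>[h]\<close>, contrary to the assumption that \<open>M\<close> is moved.\<close>
lemma generic_direction_limit:
  assumes lim: "limitin zariski (\<lambda>s. act (s *s u) origin) M cofinite" and M: "M \<in> X"
    "M \<notin> range (\<lambda>t. act t origin)" and moved: "act t M \<noteq> M"
  shows "u $ 1 * u $ 2 * (u $ 1 - u $ 2) = 0"
proof (rule ccontr)
  define a b z y where "a = u $ 1" and "b = u $ 2" and "z = u $ 3" and "y = u $ 4"
  define C l where "C = a * b * (a - b)" and "l = a - c * b"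
  define q r where "q = a ^ 2 + 2 * (c - 1) * a * b - c * b ^ 2" and "r = 2 * a * b - b ^ 2"
  assume "u $ 1 * u $ 2 * (u $ 1 - u $ 2) \<noteq> 0"
  then have C0: "C \<noteq> 0" and a0: "a \<noteq> 0" unfolding C_def a_def b_def by auto
  obtain x where x: "M = point x" "x \<noteq> 0" "x $ 1 = 0" using boundary_point[OF M] .
  have curve: "exp_act c (s *s u) basepoint $ 1 = 1" "exp_act c (s *s u) basepoint $ 2 = s * a"
    "exp_act c (s *s u) basepoint $ 3 = s * b" "exp_act c (s *s u) basepoint $ 4 = s ^ 2 * q"
    "exp_act c (s *s u) basepoint $ 5 = s * z + s ^ 2 * r"
    "exp_act c (s *s u) basepoint $ 6 = s * y + s ^ 2 * l * z + s ^ 3 * C" for s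
    unfolding exp_act_basepoint vector_6 vector_smult_component
      a_def b_def z_def y_def C_def l_def q_def r_def
    by (simp_all add: algebra_simps power2_eq_square power3_eq_cube)
  note zero = form_zero_at_orbit_limit[OF lim[unfolded x(1)] x(2)]
  have poly: "(\<lambda>x :: 'k ^ 6. x $ i) \<in> affine_polys" for i by (rule affine_polys_coord)
  note poly_intros = polynomial_functions_intros poly[unfolded affine_polys_def]
  \<comment> \<open>On the curve the first two coordinates are \<open>1\<close> and \<open>s * a\<close>. Substituting \<open>s\<close> in the last coordinate gives
    a cubic form that reduces to \<open>C * x $ 2 ^ 3\<close> on the boundary.\<close>
  have x2: "x $ 2 = 0"
  proof -
    have "(\<lambda>x :: 'k ^ 6. C * x $ 2 ^ 3 - a ^ 3 * x $ 6 * x $ 1 ^ 2 + a ^ 2 * y * x $ 2 * x $ 1 ^ 2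
        + a * l * z * x $ 2 ^ 2 * x $ 1) \<in> forms 3"
      by (rule formsI, unfold affine_polys_def, intro poly_intros)
        (simp add: algebra_simps power2_eq_square power3_eq_cube)
    from zero[OF this] have "C * x $ 2 ^ 3 - a ^ 3 * x $ 6 * x $ 1 ^ 2 + a ^ 2 * y * x $ 2 * x $ 1 ^ 2
        + a * l * z * x $ 2 ^ 2 * x $ 1 = 0"
      unfolding curve by (simp add: algebra_simps power2_eq_square power3_eq_cube)
    then show ?thesis using C0 x(3) by simp
  qed
  have x3: "x $ 3 = 0"
  proof -
    have "(\<lambda>x :: 'k ^ 6. a * x $ 3 - b * x $ 2) \<in> forms 1"
      by (rule formsI, unfold affine_polys_def, intro poly_intros) (simp add: algebra_simps)
    from zero[OF this] have "a * x $ 3 - b * x $ 2 = 0" unfolding curve by simp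
    then show ?thesis using a0 x2 by simp
  qed
  \<comment> \<open>The square of \<open>k * s ^ 2\<close> and the product of the second and the last coordinate have proportional terms of
    degree 4 in \<open>s\<close>. Once these cancel, what remains consists of multiples of the products of the second
    coordinate with itself and with \<open>h\<close>.\<close>
  have quadratic: "h x = 0"
    if h: "h \<in> forms 1" "\<And>s. h (exp_act c (s *s u) basepoint) = k * s ^ 2" for h k
  proof -
    have "(\<lambda>x. C * a ^ 2 * h x ^ 2 - a * k ^ 2 * x $ 2 * x $ 6 + k ^ 2 * y * x $ 2 ^ 2
        + a * k * l * z * h x * x $ 2) \<in> forms 2"
      using h(1) unfolding forms_def affine_polys_def
      by (auto intro!: poly_intros simp: algebra_simps power2_eq_square)
    from zero[OF this] have "C * a ^ 2 * h x ^ 2 - a * k ^ 2 * x $ 2 * x $ 6 + k ^ 2 * y * x $ 2 ^ 2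
        + a * k * l * z * h x * x $ 2 = 0"
      unfolding curve h(2) by (simp add: algebra_simps power2_eq_square power3_eq_cube)
    then show ?thesis using C0 a0 x2 by simp
  qed
  have x4: "x $ 4 = 0"
  proof (rule quadratic)
    show "(\<lambda>x :: 'k ^ 6. x $ 4) \<in> forms 1" by (rule formsI) (simp_all add: poly)
    show "exp_act c (s *s u) basepoint $ 4 = q * s ^ 2" for s
      unfolding curve by (rule mult.commute)
  qed
  have "a * x $ 5 - z * x $ 2 = 0"
  proof (rule quadratic)
    show "(\<lambda>x :: 'k ^ 6. a * x $ 5 - z * x $ 2) \<in> forms 1"
      by (rule formsI, unfold affine_polys_def, intro poly_intros) (simp add: algebra_simps)
    show "a * exp_act c (s *s u) basepoint $ 5 - z * exp_act c (s *s u) basepoint $ 2 = (a * r) * s ^ 2" for s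
      unfolding curve by (simp add: algebra_simps)
  qed
  then have x5: "x $ 5 = 0" using a0 x2 by simp
  show False using moved stabilizer_of_vertex_plane[OF x(2,3) x2 x3] x4 x5 x(1) by simp
qed

text \<open>For \<open>u\<close> in \<open>\<langle>g, h\<rangle>\<close> the curve is the line through \<open>[1]\<close> and \<open>[u]\<close>. Its limits in the boundary lie in \<open>\<P>(\<langle>g, h\<rangle>)\<close>,
and each of them but \<open>[h]\<close> has the annihilator of \<open>g\<close> as stabilizer.\<close>
lemma ideal_direction_limit:
  assumes lim: "limitin zariski (\<lambda>s. act (s *s u) origin) M cofinite" and M: "M \<in> X"
    "M \<notin> range (\<lambda>t. act t origin)" and moved: "act t' M \<noteq> M" and u: "u $ 1 = 0" "u $ 2 = 0"
  shows "act t M = M \<longleftrightarrow> t $ 1 = c * t $ 2"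
proof -
  obtain x where x: "M = point x" "x \<noteq> 0" "x $ 1 = 0" using boundary_point[OF M] .
  have curve: "exp_act c (s *s u) basepoint $ 2 = 0" "exp_act c (s *s u) basepoint $ 3 = 0"
    "exp_act c (s *s u) basepoint $ 4 = 0" for s
    unfolding exp_act_basepoint vector_6 vector_smult_component by (simp_all add: u)
  have coord: "(\<lambda>x. x $ i) \<in> forms 1" for i :: 6
    by (rule formsI) (simp_all add: affine_polys_coord)
  note zero = form_zero_at_orbit_limit[OF lim[unfolded x(1)] x(2) coord]
  have x0: "x $ 2 = 0" "x $ 3 = 0" "x $ 4 = 0"
    using zero[of 2] zero[of 3] zero[of 4] by (simp_all add: curve)
  note stab = stabilizer_of_vertex_plane[OF x(2,3) x0(1,2), folded x(1), unfolded x0(3)]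
  have "x $ 5 \<noteq> 0" using moved stab[of t'] by auto
  then show ?thesis using stab[of t] by simp
qed

end

section \<open>The cross-ratio\<close>

definition linear_form :: "('k::field ^ 'n \<Rightarrow> 'k) \<Rightarrow> bool" where
  "linear_form f \<longleftrightarrow> (\<forall>x y k. f (x + k *s y) = f x + k * f y)"

text \<open>A vector space over an infinite field is not a finite union of proper subspaces.\<close>
lemma linear_forms_avoid:
  fixes F :: "('k::field_char_0 ^ 'n \<Rightarrow> 'k) set"
  assumes fin: "finite F" and W: "W \<noteq> {}" "\<And>x y k. x \<in> W \<Longrightarrow> y \<in> W \<Longrightarrow> x + k *s y \<in> W"
    and lin: "\<And>f. f \<in> F \<Longrightarrow> linear_form f" and nz: "\<And>f. f \<in> F \<Longrightarrow> \<exists>w\<in>W. f w \<noteq> 0"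
  shows "\<exists>w\<in>W. \<forall>f\<in>F. f w \<noteq> 0"
  using fin lin nz
proof (induction F)
  case empty then show ?case using W(1) by blast
next
  case (insert f F)
  obtain w where w: "w \<in> W" "\<And>g. g \<in> F \<Longrightarrow> g w \<noteq> 0"
    using insert.IH insert.prems by (meson insertI2)
  obtain p where p: "p \<in> W" "f p \<noteq> 0" using insert.prems(2) by blast
  have "finite {k. g (w + k *s p) = 0}" if g: "g \<in> insert f F" for g
  proof -
    have eq: "g (w + k *s p) = g w + k * g p" for k
      using insert.prems(1)[OF g] unfolding linear_form_def by blast
    show ?thesis
    proof (cases "g p = 0")
      case True
      then have "g w \<noteq> 0" using g w(2) p(2) by blast
      then show ?thesis by (simp add: eq True)
    next
      case False
      then have "{k. g (w + k *s p) = 0} \<subseteq> {- g w / g p}"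
        unfolding eq by (auto simp: field_simps add_eq_0_iff)
      then show ?thesis by (rule finite_subset) simp
    qed
  qed
  then have "finite (\<Union>g\<in>insert f F. {k. g (w + k *s p) = 0})" using insert.hyps(1) by blast
  then obtain k where "k \<notin> (\<Union>g\<in>insert f F. {k. g (w + k *s p) = 0})"
    using ex_new_if_finite[OF infinite_UNIV_char_0] by blast
  then show ?case using W(2)[OF w(1) p(1)] by (intro bexI[of _ "w + k *s p"]) auto
qed

text \<open>Additivity gives homogeneity for natural numbers \<open>k\<close>. As both sides are polynomials in \<open>k\<close>, they agree
everywhere in characteristic zero.\<close>
lemma additive_polynomial_scale:
  fixes f :: "'k::field_char_0 ^ 'm \<Rightarrow> 'k"
  assumes poly: "f \<in> affine_polys" and add: "\<And>s t. f (s + t) = f s + f t"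
  shows "f (k *s t) = k * f t"
proof -
  have "(\<lambda>x. f (x *s t)) \<in> polynomial_functions {\<lambda>x. x}"
    by (rule affine_polys_compose[where g = "\<lambda>x. x *s t", OF poly])
      (simp add: polynomial_functions.mult polynomial_functions.const polynomial_functions.coord)
  then obtain p where p: "\<And>x. f (x *s t) = poly p x" using univariate_polynomial_function by blast
  have f0: "f 0 = 0" using add[of 0 0] by simp
  have nat: "f (of_nat n *s t) = of_nat n * f t" for n
  proof (induction n)
    case (Suc n)
    have "of_nat (Suc n) *s t = t + of_nat n *s t" by (simp add: vec_eq_iff algebra_simps)
    then show ?case using Suc add by (simp add: algebra_simps)
  qed (simp add: f0)
  define q where "q = p - [:0, f t:]"
  have q: "poly q x = f (x *s t) - x * f t" for x by (simp add: q_def p)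
  have "range (of_nat :: nat \<Rightarrow> 'k) \<subseteq> {x. poly q x = 0}" using nat by (auto simp: q)
  moreover have "infinite (range (of_nat :: nat \<Rightarrow> 'k))"
    by (intro range_inj_infinite injI) simp
  ultimately have "q = 0" using poly_roots_finite[of q] finite_subset by blast
  then show ?thesis using q[of k] by simp
qed

text \<open>Each of the hyperplanes \<open>a = 0\<close>, \<open>b = 0\<close>, \<open>a = b\<close> is mapped into the union of the three, hence into one of them. Surjectivity
makes this a permutation, and in particular \<open>\<langle>g, h\<rangle>\<close>, the intersection of any two, is preserved. In the
quotient by \<open>\<langle>g, h\<rangle>\<close> the matrix of the induced map is then determined up to a scalar by the permutation, and the
image of the vector \<open>(c, 1)\<close> must be proportional to \<open>(c', 1)\<close>. The conclusion lists the six permutations.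

The hyperplanes are known to be preserved only where \<open>t\<^sub>3 \<noteq> 0\<close>, since the direction of \<open>h\<close> is exceptional for limits; a vector
of this kind avoiding the kernels of all the linear forms in question exists by \<open>linear_forms_avoid\<close>.\<close>
lemma special_hyperplanes_permuted:
  fixes \<psi> :: "'k::field_char_0 ^ 4 \<Rightarrow> 'k ^ 4"
  assumes add: "\<And>s t. \<psi> (s + t) = \<psi> s + \<psi> t" and scale: "\<And>k t. \<psi> (k *s t) = k *s \<psi> t"
    and surj: "surj \<psi>"
    and planes: "\<And>u. u $ 1 * u $ 2 * (u $ 1 - u $ 2) = 0 \<Longrightarrow> u $ 3 \<noteq> 0 \<Longrightarrow>
      \<psi> u $ 1 * \<psi> u $ 2 * (\<psi> u $ 1 - \<psi> u $ 2) = 0"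
    and kernel: "\<And>t. \<psi> (axis 3 1) $ 1 = 0 \<Longrightarrow> \<psi> (axis 3 1) $ 2 = 0 \<Longrightarrow> t $ 1 = c * t $ 2 \<Longrightarrow>
      \<psi> t $ 1 = c' * \<psi> t $ 2"
  shows "c = c' \<or> c = c' * (c - 1) \<or> 1 = c' * c \<or> 1 = c' * (1 - c) \<or> c - 1 = c' * c \<or> 1 - c = c'"
proof -
  define A where "A u = \<psi> u $ 1" for u
  define B where "B u = \<psi> u $ 2" for u
  define D where "D u = A u - B u" for u
  have linA: "linear_form A" and linB: "linear_form B" and linD: "linear_form D"
    by (simp_all add: linear_form_def A_def B_def D_def add scale algebra_simps)
  have lin3: "linear_form (\<lambda>u. u $ 3)" by (simp add: linear_form_def)
  define e where "e i = (axis i 1 :: 'k ^ 4)" for i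
  have e: "e i $ j = (if i = j then 1 else 0)" for i j by (simp add: e_def axis_def)
  have vanish: "(\<forall>w\<in>W. A w = 0) \<or> (\<forall>w\<in>W. B w = 0) \<or> (\<forall>w\<in>W. D w = 0)"
    if W: "\<And>x y k. x \<in> W \<Longrightarrow> y \<in> W \<Longrightarrow> x + k *s y \<in> W" "e 3 \<in> W"
      "\<And>w. w \<in> W \<Longrightarrow> w $ 1 * w $ 2 * (w $ 1 - w $ 2) = 0" for W
  proof (rule ccontr)
    assume neg: "\<not> ?thesis"
    have "\<exists>w\<in>W. \<forall>f\<in>{A, B, D, \<lambda>u. u $ 3}. f w \<noteq> 0"
    proof (rule linear_forms_avoid)
      show "\<exists>w\<in>W. f w \<noteq> 0" if "f \<in> {A, B, D, \<lambda>u. u $ 3}" for f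
      proof -
        have "e 3 $ 3 \<noteq> 0" by (simp add: e)
        then show ?thesis using that neg W(2) by blast
      qed
    qed (use W linA linB linD lin3 in auto)
    then obtain w where "w \<in> W" "A w \<noteq> 0" "B w \<noteq> 0" "D w \<noteq> 0" "w $ 3 \<noteq> 0" by auto
    then show False using planes[of w] W(3) unfolding A_def B_def D_def by auto
  qed
  have sum: "f (x + k *s y) = f x + k * f y" if "linear_form f" for f :: "'k ^ 4 \<Rightarrow> 'k" and x y k
    using that unfolding linear_form_def by blast
  have f12: "f (k *s e 1 + j *s e 2) = k * f (e 1) + j * f (e 2)" if "linear_form f" for f k j
  proof -
    have "f 0 = 0" using sum[OF that, of 0 1 0] by simp
    then show ?thesis using sum[OF that, of 0 k "e 1"] sum[OF that, of "k *s e 1" j "e 2"] by simp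
  qed
  have expand: "f u = u $ 1 * f (e 1) + u $ 2 * f (e 2)"
    if "linear_form f" "f (e 3) = 0" "f (e 4) = 0" for f u
  proof -
    have "u = u $ 1 *s e 1 + u $ 2 *s e 2 + u $ 3 *s e 3 + u $ 4 *s e 4"
      by (simp add: vec_eq_iff forall_4 e)
    then have "f u = f (u $ 1 *s e 1 + u $ 2 *s e 2 + u $ 3 *s e 3 + u $ 4 *s e 4)" by simp
    also have "\<dots> = u $ 1 * f (e 1) + u $ 2 * f (e 2)"
      unfolding sum[OF that(1)] that(2,3) using f12[OF that(1), of "u $ 1" 0] by simp
    finally show ?thesis .
  qed
  define Z where "Z f W \<longleftrightarrow> (\<forall>w\<in>W. f w = 0)" for f :: "'k ^ 4 \<Rightarrow> 'k" and W
  let ?W1 = "{w :: 'k ^ 4. w $ 1 = 0}" and ?W2 = "{w :: 'k ^ 4. w $ 2 = 0}" and ?W3 = "{w :: 'k ^ 4. w $ 1 = w $ 2}"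
  have V1: "Z A ?W1 \<or> Z B ?W1 \<or> Z D ?W1" and V2: "Z A ?W2 \<or> Z B ?W2 \<or> Z D ?W2"
    and V3: "Z A ?W3 \<or> Z B ?W3 \<or> Z D ?W3"
    unfolding Z_def by (rule vanish; auto simp: e)+
  have Z1: "f (e 2) = 0 \<and> f (e 3) = 0 \<and> f (e 4) = 0" if "Z f ?W1" for f
    using that unfolding Z_def by (simp add: e)
  have Z2: "f (e 1) = 0 \<and> f (e 3) = 0 \<and> f (e 4) = 0" if "Z f ?W2" for f
    using that unfolding Z_def by (simp add: e)
  have Z3: "f (e 1) + f (e 2) = 0 \<and> f (e 3) = 0 \<and> f (e 4) = 0" if "Z f ?W3" "linear_form f" for f
  proof -
    have "f (1 *s e 1 + 1 *s e 2) = 0" using that(1) unfolding Z_def by (simp add: e)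
    then show ?thesis using that(1) f12[OF that(2), of 1 1] unfolding Z_def by (simp add: e)
  qed
  have nonzero: "\<exists>u. f u \<noteq> 0" if "f \<in> {A, B, D}" for f
  proof -
    obtain u where "\<psi> u = e 1 + 2 *s e 2" using surj by (metis surjD)
    then have "A u = 1" "B u = 2" "D u = -1" by (simp_all add: A_def B_def D_def e)
    then show ?thesis using that by (metis insertE neg_equal_0_iff_equal singletonD zero_neq_numeral zero_neq_one)
  qed
  have ne: "f (e 1) \<noteq> 0 \<or> f (e 2) \<noteq> 0"
    if "f \<in> {A, B, D}" "f (e 3) = 0" "f (e 4) = 0" for f
  proof -
    from nonzero[OF that(1)] obtain u where "f u \<noteq> 0" by blast
    moreover have "linear_form f" using that(1) linA linB linD by blast
    ultimately show ?thesis using expand[of f u] that by auto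
  qed
  have once: "\<not> (Z f ?W1 \<and> Z f ?W2) \<and> \<not> (Z f ?W1 \<and> Z f ?W3) \<and> \<not> (Z f ?W2 \<and> Z f ?W3)"
    if "f \<in> {A, B, D}" for f
  proof -
    have lin: "linear_form f" using that linA linB linD by blast
    show ?thesis using ne[OF that] Z1[of f] Z2[of f] Z3[OF _ lin] by auto
  qed
  let ?v = "c *s e 1 + 1 *s e 2"
  have line: "c * A (e 1) + A (e 2) = c' * (c * B (e 1) + B (e 2))"
    if "A (e 3) = 0" "B (e 3) = 0"
  proof -
    have "A ?v = c' * B ?v"
      using kernel[of ?v] that by (simp add: A_def B_def e_def[symmetric] e)
    then show ?thesis unfolding f12[OF linA] f12[OF linB] by simp
  qed
  have D: "D u = A u - B u" for u by (rule D_def)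
  have mem: "A \<in> {A, B, D}" "B \<in> {A, B, D}" "D \<in> {A, B, D}" by simp_all
  have "(Z A ?W1 \<and> Z B ?W2 \<and> Z D ?W3) \<or> (Z A ?W1 \<and> Z D ?W2 \<and> Z B ?W3)
      \<or> (Z B ?W1 \<and> Z A ?W2 \<and> Z D ?W3) \<or> (Z D ?W1 \<and> Z A ?W2 \<and> Z B ?W3)
      \<or> (Z B ?W1 \<and> Z D ?W2 \<and> Z A ?W3) \<or> (Z D ?W1 \<and> Z B ?W2 \<and> Z A ?W3)"
    using V1 V2 V3 once[OF mem(1)] once[OF mem(2)] once[OF mem(3)] by argo
  then consider "Z A ?W1" "Z B ?W2" "Z D ?W3" | "Z A ?W1" "Z D ?W2" "Z B ?W3"
    | "Z B ?W1" "Z A ?W2" "Z D ?W3" | "Z D ?W1" "Z A ?W2" "Z B ?W3"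
    | "Z B ?W1" "Z D ?W2" "Z A ?W3" | "Z D ?W1" "Z B ?W2" "Z A ?W3" by argo
  then show ?thesis
  proof cases
    case 1
    have *: "A (e 2) = 0" "B (e 1) = 0" "B (e 2) = A (e 1)" "A (e 3) = 0" "B (e 3) = 0" "A (e 4) = 0"
      using Z1[OF 1(1)] Z2[OF 1(2)] Z3[OF 1(3) linD]
      by (simp_all add: D eq_neg_iff_add_eq_0 add.commute)
    have "A (e 1) * (c - c') = 0" using line[OF *(4,5)] unfolding *(1-3) by (simp add: algebra_simps)
    moreover have "A (e 1) \<noteq> 0" using ne[of A] * by auto
    ultimately show ?thesis by simp
  next
    case 2
    have *: "A (e 2) = 0" "B (e 1) = A (e 1)" "B (e 2) = - A (e 1)" "A (e 3) = 0" "B (e 3) = 0" "A (e 4) = 0"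
      using Z1[OF 2(1)] Z2[OF 2(2)] Z3[OF 2(3) linB]
      by (simp_all add: D eq_neg_iff_add_eq_0 add.commute)
    have "A (e 1) * (c - c' * (c - 1)) = 0" using line[OF *(4,5)] unfolding *(1-3) by (simp add: algebra_simps)
    moreover have "A (e 1) \<noteq> 0" using ne[of A] * by auto
    ultimately show ?thesis by simp
  next
    case 3
    have *: "A (e 1) = 0" "B (e 1) = A (e 2)" "B (e 2) = 0" "A (e 3) = 0" "B (e 3) = 0" "A (e 4) = 0"
      using Z1[OF 3(1)] Z2[OF 3(2)] Z3[OF 3(3) linD]
      by (simp_all add: D eq_neg_iff_add_eq_0 add.commute)
    have "A (e 2) * (1 - c' * c) = 0" using line[OF *(4,5)] unfolding *(1-3) by (simp add: algebra_simps)
    moreover have "A (e 2) \<noteq> 0" using ne[of A] * by auto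
    ultimately show ?thesis by simp
  next
    case 4
    have *: "A (e 1) = 0" "B (e 1) = - A (e 2)" "B (e 2) = A (e 2)" "A (e 3) = 0" "B (e 3) = 0" "A (e 4) = 0"
      using Z1[OF 4(1)] Z2[OF 4(2)] Z3[OF 4(3) linB]
      by (simp_all add: D eq_neg_iff_add_eq_0 add.commute)
    have "A (e 2) * (1 - c' * (1 - c)) = 0" using line[OF *(4,5)] unfolding *(1-3) by (simp add: algebra_simps)
    moreover have "A (e 2) \<noteq> 0" using ne[of A] * by auto
    ultimately show ?thesis by simp
  next
    case 5
    have *: "A (e 2) = - A (e 1)" "B (e 1) = A (e 1)" "B (e 2) = 0" "A (e 3) = 0" "B (e 3) = 0" "A (e 4) = 0"
      using Z1[OF 5(1)] Z2[OF 5(2)] Z3[OF 5(3) linA]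
      by (simp_all add: D eq_neg_iff_add_eq_0 add.commute)
    have "A (e 1) * (c - 1 - c' * c) = 0" using line[OF *(4,5)] unfolding *(1-3) by (simp add: algebra_simps)
    moreover have "A (e 1) \<noteq> 0" using ne[of A] * by auto
    ultimately show ?thesis by simp
  next
    case 6
    have *: "A (e 1) = - A (e 2)" "B (e 1) = 0" "B (e 2) = A (e 2)" "A (e 3) = 0" "B (e 3) = 0" "A (e 4) = 0"
      using Z1[OF 6(1)] Z2[OF 6(2)] Z3[OF 6(3) linA]
      by (simp_all add: D eq_neg_iff_add_eq_0 add.commute)
    have "A (e 2) * (1 - c - c') = 0" using line[OF *(4,5)] unfolding *(1-3) by (simp add: algebra_simps)
    moreover have "A (e 2) \<noteq> 0" using ne[of A] * by auto
    ultimately show ?thesis by simp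
  qed
qed

text \<open>A continuous injective equivariant map transports limits of one-parameter subgroups and stabilizers from the
first action to the second, which makes \<open>special_hyperplanes_permuted\<close> applicable to \<open>\<psi>\<close>.\<close>
lemma equivalent_actions_parameters:
  fixes c c' :: "'k::field_char_0"
  assumes A: "quadric_frame_action c R P X" and B: "quadric_frame_action c' R' P' X"
    and equiv: "equivariantly_isomorphic_upto_aut X
      (quadric_frame_action.act c R P) X (quadric_frame_action.act c' R' P')"
  shows "c = c' \<or> c = c' * (c - 1) \<or> 1 = c' * c \<or> 1 = c' * (1 - c) \<or> c - 1 = c' * c \<or> 1 - c = c'"
proof -
  interpret A: quadric_frame_action c R P X by (rule A)
  interpret B: quadric_frame_action c' R' P' X by (rule B)
  obtain \<psi> \<phi> where \<psi>: "Ga_automorphism \<psi>" and \<phi>: "variety_iso X X \<phi>"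
    and equi: "\<And>t L. L \<in> X \<Longrightarrow> \<phi> (A.act t L) = B.act (\<psi> t) (\<phi> L)"
    using equiv unfolding equivariantly_isomorphic_upto_aut_def equivariantly_isomorphic_def by blast
  have bij: "bij \<psi>" and add: "\<And>s t. \<psi> (s + t) = \<psi> s + \<psi> t"
    and poly: "\<And>i. (\<lambda>t. \<psi> t $ i) \<in> affine_polys"
    using \<psi> unfolding Ga_automorphism_def by blast+
  have scale: "\<psi> (k *s t) = k *s \<psi> t" for k t
    using additive_polynomial_scale[OF poly] add by (simp add: vec_eq_iff)
  have \<psi>0: "\<psi> t = 0 \<longleftrightarrow> t = 0" for t
    using bij scale[of 0 0] by (metis bij_pointE vector_smult_lzero)
  have reg: "regular_map X X \<phi>" using \<phi> unfolding variety_iso_def by blast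
  have into: "\<phi> L \<in> X" if "L \<in> X" for L using reg that unfolding regular_map_def by blast
  from \<phi> have "\<exists>\<theta>. regular_map X X \<theta> \<and> (\<forall>L\<in>X. \<theta> (\<phi> L) = L) \<and> (\<forall>M\<in>X. \<phi> (\<theta> M) = M)"
    unfolding variety_iso_def by (rule conjunct2)
  then have "inj_on \<phi> X" by (elim exE conjE) (rule inj_on_inverseI, erule (1) bspec)
  then have inj: "\<phi> L = \<phi> M \<longleftrightarrow> L = M" if "L \<in> X" "M \<in> X" for L M
    using that by (rule inj_on_eq_iff)
  have stab: "B.act (\<psi> t) (\<phi> L) = \<phi> L \<longleftrightarrow> A.act t L = L" if "L \<in> X" for t L
    using equi[OF that] inj[OF A.act_in_X[OF that] that] by metis
  have stab_nontrivial: "(\<exists>t. t \<noteq> 0 \<and> B.act t Y = Y) \<longleftrightarrow> (\<exists>t. t \<noteq> 0 \<and> A.act t L = L)"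
    if "\<And>t. B.act (\<psi> t) Y = Y \<longleftrightarrow> A.act t L = L" for Y L
  proof -
    have ex: "(\<exists>t. Q t) \<longleftrightarrow> (\<exists>t. Q (\<psi> t))" for Q using bij_is_surj[OF bij] by (metis surjD)
    show ?thesis unfolding ex[of "\<lambda>t. t \<noteq> 0 \<and> B.act t Y = Y"] \<psi>0 that ..
  qed
  have orbit: "\<phi> L \<in> range (\<lambda>t. B.act t B.origin) \<longleftrightarrow> L \<in> range (\<lambda>t. A.act t A.origin)"
    if "L \<in> X" for L
    using A.boundary_iff_stabilizer[OF that] B.boundary_iff_stabilizer[OF into[OF that]]
      stab_nontrivial[OF stab[OF that]] by argo
  have "A.origin \<in> range (\<lambda>t. A.act t A.origin)"
    using A.act_zero[OF A.origin_in_X] by (metis rangeI)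
  then obtain v where v: "\<phi> A.origin = B.act v B.origin" using orbit[OF A.origin_in_X] by blast
  \<comment> \<open>The isomorphism corrected by a translation, which sends base point to base point.\<close>
  define \<eta> where "\<eta> L = B.act (- v) (\<phi> L)" for L
  have \<eta>_back: "\<phi> L = B.act v (\<eta> L)" if "L \<in> X" for L
    unfolding \<eta>_def using B.act_add[OF into[OF that], of v "- v"] B.act_zero[OF into[OF that]] by simp
  have \<eta>_in: "\<eta> L \<in> X" if "L \<in> X" for L
    unfolding \<eta>_def using that into B.act_in_X by blast
  have \<eta>_stab: "B.act (\<psi> t) (\<eta> L) = \<eta> L \<longleftrightarrow> A.act t L = L" if "L \<in> X" for t L
  proof -
    have "B.act (\<psi> t) (\<eta> L) = B.act (- v) (B.act (\<psi> t) (\<phi> L))"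
      unfolding \<eta>_def by (simp add: add.commute flip: B.act_add[OF into[OF that]])
    moreover have "B.act v (B.act (- v) (B.act (\<psi> t) (\<phi> L))) = B.act (\<psi> t) (\<phi> L)"
      using B.act_in_X[OF into[OF that]] by (simp add: B.act_zero flip: B.act_add)
    ultimately show ?thesis using stab[OF that] \<eta>_back[OF that] \<eta>_def by metis
  qed
  have \<eta>_orbit: "\<eta> M \<notin> range (\<lambda>t. B.act t B.origin)"
    if "M \<in> X" "M \<notin> range (\<lambda>t. A.act t A.origin)" for M
    using A.boundary_iff_stabilizer[OF that(1)] B.boundary_iff_stabilizer[OF \<eta>_in[OF that(1)]]
      stab_nontrivial[OF \<eta>_stab[OF that(1)]] that(2) by argo
  have \<eta>_limit: "limitin zariski (\<lambda>s. B.act (s *s \<psi> u) B.origin) (\<eta> M) cofinite"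
    if M: "M \<in> X" and lim: "limitin zariski (\<lambda>s. A.act (s *s u) A.origin) M cofinite" for M u
  proof -
    note in_X = A.act_in_X[OF A.origin_in_X]
    have "limitin zariski (\<lambda>s. \<phi> (A.act (s *s u) A.origin)) (\<phi> M) cofinite"
      by (rule regular_map_limit[OF reg A.X_lines M in_X lim])
    from regular_map_limit[OF B.act_regular A.X_lines into[OF M] into[OF in_X] this, of "- v"]
    have "limitin zariski (\<lambda>s. B.act (- v) (\<phi> (A.act (s *s u) A.origin))) (\<eta> M) cofinite"
      unfolding \<eta>_def .
    also have "(\<lambda>s. B.act (- v) (\<phi> (A.act (s *s u) A.origin))) = (\<lambda>s. B.act (s *s \<psi> u) B.origin)"
      unfolding equi[OF A.origin_in_X] v scale
      by (simp add: B.origin_in_X algebra_simps flip: B.act_add)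
    finally show ?thesis .
  qed
  have special: "\<exists>M t. M \<in> X \<and> limitin zariski (\<lambda>s. A.act (s *s u) A.origin) M cofinite \<and>
      M \<notin> range (\<lambda>t. A.act t A.origin) \<and> A.act t M \<noteq> M"
    if "u $ 1 * u $ 2 * (u $ 1 - u $ 2) = 0" "u $ 3 \<noteq> 0" for u
    using A.special_direction_limit[OF that(1)] that(2) by metis
  show ?thesis
  proof (rule special_hyperplanes_permuted[of \<psi>, OF add scale])
    show "surj \<psi>" using bij by (rule bij_is_surj)
  next
    fix u :: "'k ^ 4" assume u: "u $ 1 * u $ 2 * (u $ 1 - u $ 2) = 0" "u $ 3 \<noteq> 0"
    from special[OF u] obtain M t where M: "M \<in> X" "limitin zariski (\<lambda>s. A.act (s *s u) A.origin) M cofinite"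
      "M \<notin> range (\<lambda>t. A.act t A.origin)" "A.act t M \<noteq> M" by (elim exE conjE) (rule that)
    have "B.act (\<psi> t) (\<eta> M) \<noteq> \<eta> M" using \<eta>_stab[OF M(1)] M(4) by blast
    then show "\<psi> u $ 1 * \<psi> u $ 2 * (\<psi> u $ 1 - \<psi> u $ 2) = 0"
      by (rule B.generic_direction_limit[OF \<eta>_limit[OF M(1,2)] \<eta>_in[OF M(1)] \<eta>_orbit[OF M(1,3)]])
  next
    fix t :: "'k ^ 4" assume J: "\<psi> (axis 3 1) $ 1 = 0" "\<psi> (axis 3 1) $ 2 = 0" and t: "t $ 1 = c * t $ 2"
    let ?u = "axis 3 1 :: 'k ^ 4"
    have u: "?u $ 1 = 0" "?u $ 2 = 0" "?u $ 1 * ?u $ 2 * (?u $ 1 - ?u $ 2) = 0" "?u $ 3 \<noteq> 0"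
      by (simp_all add: axis_def)
    from special[OF u(3,4)] obtain M t' where M: "M \<in> X" "limitin zariski (\<lambda>s. A.act (s *s ?u) A.origin) M cofinite"
      "M \<notin> range (\<lambda>t. A.act t A.origin)" "A.act t' M \<noteq> M" by (elim exE conjE) (rule that)
    have "A.act t M = M" using A.ideal_direction_limit[OF M(2,1,3,4) u(1,2)] t by blast
    then have fix_t: "B.act (\<psi> t) (\<eta> M) = \<eta> M" using \<eta>_stab[OF M(1)] by blast
    have "B.act (\<psi> t') (\<eta> M) \<noteq> \<eta> M" using \<eta>_stab[OF M(1)] M(4) by blast
    from B.ideal_direction_limit[OF \<eta>_limit[OF M(1,2)] \<eta>_in[OF M(1)] \<eta>_orbit[OF M(1,3)] this J]
    show "\<psi> t $ 1 = c' * \<psi> t $ 2" using fix_t by blast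
  qed
qed

section \<open>Infinitely many equivalence classes\<close>

lemma equivariantly_isomorphic_refl:
  assumes X: "X \<subseteq> {line z | z. z \<noteq> 0}"
  shows "equivariantly_isomorphic X \<alpha> X \<alpha>"
proof -
  have "regular_map X X (\<lambda>L. L)" unfolding regular_map_def
  proof (intro conjI ballI)
    fix L assume "L \<in> X"
    moreover have "(\<lambda>z. z $ i) \<in> forms 1" for i by (rule formsI) (simp_all add: affine_polys_coord)
    ultimately show "\<exists>U d f. openin zariski U \<and> L \<in> U \<and> (\<forall>i. f i \<in> forms d) \<and>
        (\<forall>z. z \<noteq> 0 \<and> line z \<in> X \<inter> U \<longrightarrow> (\<chi> i. f i z) \<noteq> 0 \<and> line z = line (\<chi> i. f i z))"
      using X openin_zariski_lines
      by (intro exI[of _ "{line z | z. z \<noteq> 0}"] exI[of _ 1] exI[of _ "\<lambda>i z. z $ i"]) auto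
  qed simp
  then have "variety_iso X X (\<lambda>L. L)" unfolding variety_iso_def by auto
  then show ?thesis unfolding equivariantly_isomorphic_def by (intro exI[of _ "\<lambda>L. L"]) simp
qed

lemma equivariantly_isomorphic_imp_upto_aut:
  assumes "equivariantly_isomorphic X \<alpha> Y \<beta>" shows "equivariantly_isomorphic_upto_aut X \<alpha> Y \<beta>"
proof -
  have "inv (\<lambda>t :: 'a ^ 'c. t) = (\<lambda>t. t)" using inv_id unfolding id_def .
  then have "Ga_automorphism (\<lambda>t :: 'a ^ 'c. t)"
    unfolding Ga_automorphism_def by (simp add: affine_polys_coord bij_id[unfolded id_def])
  then show ?thesis
    unfolding equivariantly_isomorphic_upto_aut_def using assms by (intro exI[of _ "\<lambda>t. t"]) simp
qed

lemma infinite_quotient: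
  fixes f :: "nat \<Rightarrow> 'a"
  assumes A: "\<And>n. f n \<in> A" and refl: "\<And>n. (f n, f n) \<in> r" and sep: "\<And>m n. (f m, f n) \<in> r \<Longrightarrow> m = n"
  shows "infinite (A // r)"
proof -
  have "inj (\<lambda>n. r `` {f n})"
    using refl sep by (intro injI) (metis Image_singleton_iff)
  then have "infinite (range (\<lambda>n. r `` {f n}))" by (rule range_inj_infinite)
  moreover have "range (\<lambda>n. r `` {f n}) \<subseteq> A // r" using A by (auto intro: quotientI)
  ultimately show ?thesis using finite_subset by blast
qed

theorem proposition6:
  fixes X :: "('k::{alg_closed_field, field_char_0} ^ 6) set set"
  assumes "is_quadric 4 4 X"
  shows "infinite ((additive_actions X :: ('k ^ 4 \<Rightarrow> ('k ^ 6) set \<Rightarrow> ('k ^ 6) set) set)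
             // strict_equivalence X) \<and>
         infinite ((additive_actions X :: ('k ^ 4 \<Rightarrow> ('k ^ 6) set \<Rightarrow> ('k ^ 6) set) set)
             // equivalence_upto_aut X)"
proof -
  obtain A :: "'k ^ 6 ^ 6" where A: "transpose A = A" "rank A = 4"
    and X: "X = {line z | z. z \<noteq> 0 \<and> matrix_form A z z = 0}"
    using assms unfolding is_quadric_def matrix_form_def by blast
  \<comment> \<open>For an integer \<open>c \<ge> 3\<close> none of the other five cross-ratios is an integer \<open>\<ge> 3\<close>.\<close>
  define c where "c n = (of_nat (n + 3) :: 'k)" for n
  have "\<exists>R P. quadric_frame_action (c n) R P X" for n
  proof -
    have "c n ^ 2 - c n + 1 = of_nat ((n + 3) * (n + 2) + 1)"
      unfolding c_def by (simp add: algebra_simps power2_eq_square)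
    also have "\<dots> \<noteq> 0" unfolding of_nat_eq_0_iff by simp
    finally obtain R where R: "invertible R" "\<And>z. matrix_form A z z = quadric_form (c n) (R *v z)"
      using quadric_frame[OF A] by blast
    from R(1) obtain P where "P ** R = mat 1" unfolding invertible_left_inverse by blast
    then have "quadric_frame_action (c n) R P X"
      by unfold_locales (simp_all add: X R(2))
    then show ?thesis by blast
  qed
  then obtain R P where frame: "\<And>n. quadric_frame_action (c n) (R n) (P n) X" by metis
  define \<alpha> where "\<alpha> n = quadric_frame_action.act (c n) (R n) (P n)" for n
  have \<alpha>: "\<alpha> n \<in> additive_actions X" for n
    unfolding additive_actions_def \<alpha>_def
    using quadric_frame_action.additive_action_act[OF frame] by blast
  have refl: "equivariantly_isomorphic X (\<alpha> n) X (\<alpha> n)" for n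
    by (rule equivariantly_isomorphic_refl) (auto simp: X)
  have sep: "m = n" if "equivariantly_isomorphic_upto_aut X (\<alpha> m) X (\<alpha> n)" for m n
  proof -
    have cases: "c m = c n \<or> c m = c n * (c m - 1) \<or> 1 = c n * c m \<or> 1 = c n * (1 - c m)
        \<or> c m - 1 = c n * c m \<or> 1 - c m = c n"
      using equivalent_actions_parameters[OF frame frame] that unfolding \<alpha>_def by blast
    have c: "c m = of_int (int m + 3)" "c n = of_int (int n + 3)" unfolding c_def by simp_all
    have "(of_int (int m + 3) :: 'k) = of_int (int n + 3) \<or>
        (of_int (int m + 3) :: 'k) = of_int ((int n + 3) * (int m + 2)) \<or>
        (of_int 1 :: 'k) = of_int ((int n + 3) * (int m + 3)) \<or>
        (of_int 1 :: 'k) = of_int ((int n + 3) * (- int m - 2)) \<or>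
        (of_int (int m + 2) :: 'k) = of_int ((int n + 3) * (int m + 3)) \<or>
        (of_int (- int m - 2) :: 'k) = of_int (int n + 3)"
      using cases unfolding c by (simp add: algebra_simps)
    then have "int m + 3 = int n + 3 \<or> int m + 3 = (int n + 3) * (int m + 2) \<or>
        1 = (int n + 3) * (int m + 3) \<or> 1 = (int n + 3) * (- int m - 2) \<or>
        int m + 2 = (int n + 3) * (int m + 3) \<or> - int m - 2 = int n + 3"
      unfolding of_int_eq_iff .
    moreover have "(int n + 3) * (int m + 2) \<ge> 3 * (int m + 2)" "(int n + 3) * (int m + 3) \<ge> 3 * (int m + 3)"
      by (rule mult_right_mono; simp)+
    moreover have "(int n + 3) * (- int m - 2) \<le> 0" by (intro mult_nonneg_nonpos) simp_all
    ultimately show "m = n" by (smt (verit) of_nat_0_le_iff of_nat_eq_iff)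
  qed
  have refl_upto: "equivariantly_isomorphic_upto_aut X (\<alpha> n) X (\<alpha> n)" for n
    by (rule equivariantly_isomorphic_imp_upto_aut[OF refl])
  have sep_strict: "m = n" if "equivariantly_isomorphic X (\<alpha> m) X (\<alpha> n)" for m n
    by (rule sep[OF equivariantly_isomorphic_imp_upto_aut[OF that]])
  show ?thesis
    by (intro conjI infinite_quotient[of \<alpha>])
      (simp_all add: \<alpha> refl refl_upto strict_equivalence_def equivalence_upto_aut_def sep sep_strict)
qed

end
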